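(* Let $a_{-1},a_0,a_1,a_2,b>0$ and $\gamma,\theta>1$ be constants, let $x_0>0$, and let $Y_0=x_0^{1-\theta}>0$. Then the stochastic differential equation $$dY_t=f(Y_t)\,dt+b(1-\theta)\,dW_t,$$ with initial value $Y_0$, admits a unique positive global solution, which almost surely satisfies $$Y_t=Y_0+\int_0^t f(Y_s)\,ds+\int_0^t b(1-\theta)\,dW_s,\qquad t\ge 0.$$
   Context: $\{W_t\}_{t\ge0}$ is a one-dimensional Brownian motion on a filtered probability space $(\Omega,\mathcal F,\{\mathcal F_t\}_{t\ge0},\mathbb P)$ satisfying the usual hypotheses. The drift $f:(0,\infty)\to\mathbb R$ is $$f(x)=(\theta-1)\Big(a_2x^{\frac{\gamma-\theta}{1-\theta}}-a_1x-a_{-1}x^{\frac{\theta+1}{\theta-1}}+a_0x^{\frac{\theta}{\theta-1}}+\tfrac12 b^2\theta x^{-1}\Big).$$ This equation arises from the Ait-Sahalia model $dX_t=(a_{-1}X_t^{-1}-a_0+a_1X_t-a_2X_t^\gamma)\,dt+bX_t^\theta\,dW_t$, $X_0=x_0$, through the Lamperti transform $Y=X^{1-\theta}$. A positive global solution is one that is defined and lies in $(0,\infty)$ for all $t\ge0$, almost surely. *)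

theory Defs
  imports "HOL-Probability.Probability"
begin

locale usual_filtered_prob_space = prob_space M + complete_measure M
  for M :: "'a measure" +
  fixes F :: "real \<Rightarrow> 'a measure"  \<comment> \<open>only times \<open>t \<ge> 0\<close> are constrained and used\<close>
  assumes subalg: "0 \<le> t \<Longrightarrow> subalgebra M (F t)"
    and mono_F: "0 \<le> s \<Longrightarrow> s \<le> t \<Longrightarrow> sets (F s) \<subseteq> sets (F t)"
    and right_cont: "0 \<le> t \<Longrightarrow> sets (F t) = (\<Inter>u\<in>{t<..}. sets (F u))"
    and null_sets_F: "null_sets M \<subseteq> sets (F 0)"

locale brownian_motion = usual_filtered_prob_space M F
  for M :: "'a measure" and F :: "real \<Rightarrow> 'a measure" +
  fixes W :: "real \<Rightarrow> 'a \<Rightarrow> real"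
  assumes adapted_W: "0 \<le> t \<Longrightarrow> W t \<in> borel_measurable (F t)"
    and start_W: "AE \<omega> in M. W 0 \<omega> = 0"
    and cont_W: "AE \<omega> in M. continuous_on {0..} (\<lambda>t. W t \<omega>)"
    and normal_incr: "0 \<le> s \<Longrightarrow> s < t \<Longrightarrow>
      distributed M lborel (\<lambda>\<omega>. W t \<omega> - W s \<omega>) (normal_density 0 (sqrt (t - s)))"
    and indep_incr: "0 \<le> s \<Longrightarrow> s < t \<Longrightarrow>
      indep_set (sets (F s)) {(\<lambda>\<omega>. W t \<omega> - W s \<omega>) -` A \<inter> space M | A. A \<in> sets borel}"

text \<open>Simple processes on \<open>[0, T]\<close>: bounded \<open>F (ts i)\<close>-measurable coefficients \<open>\<xi> i\<close>
  on the cells \<open>(ts i, ts (i + 1)]\<close>, \<open>i < n\<close>, of a partition of \<open>[0, T]\<close>.\<close>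

definition simple_process ::
  "'a measure \<Rightarrow> (real \<Rightarrow> 'a measure) \<Rightarrow> real \<Rightarrow> nat \<Rightarrow> (nat \<Rightarrow> real) \<Rightarrow> (nat \<Rightarrow> 'a \<Rightarrow> real) \<Rightarrow> bool"
where
  "simple_process M F T n ts \<xi> \<longleftrightarrow>
     ts 0 = 0 \<and> ts n = T \<and> (\<forall>i<n. ts i < ts (Suc i)) \<and>
     (\<forall>i<n. \<xi> i \<in> borel_measurable (F (ts i))) \<and>
     (\<exists>B. \<forall>i<n. \<forall>\<omega>\<in>space M. \<bar>\<xi> i \<omega>\<bar> \<le> B)"

definition simple_value ::
  "nat \<Rightarrow> (nat \<Rightarrow> real) \<Rightarrow> (nat \<Rightarrow> 'a \<Rightarrow> real) \<Rightarrow> real \<Rightarrow> 'a \<Rightarrow> real"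
where
  "simple_value n ts \<xi> s \<omega> = (\<Sum>i<n. \<xi> i \<omega> * indicator {ts i<..ts (Suc i)} s)"

definition simple_integral ::
  "(real \<Rightarrow> 'a \<Rightarrow> real) \<Rightarrow> nat \<Rightarrow> (nat \<Rightarrow> real) \<Rightarrow> (nat \<Rightarrow> 'a \<Rightarrow> real) \<Rightarrow> 'a \<Rightarrow> real"
where
  "simple_integral W n ts \<xi> \<omega> = (\<Sum>i<n. \<xi> i \<omega> * (W (ts (Suc i)) \<omega> - W (ts i) \<omega>))"

text \<open>\<open>J\<close> is (a version of) the \<open>L\<^sup>2\<close> Ito integral of \<open>H\<close> with respect to \<open>W\<close> over
  \<open>[0, T]\<close>: the mean-square limit of the integrals of simple processes that converge to \<open>H\<close>
  in \<open>L\<^sup>2([0, T] \<times> \<Omega>)\<close>. The integral is determined only almost surely, hence a relation.\<close>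

definition is_ito_integral ::
  "'a measure \<Rightarrow> (real \<Rightarrow> 'a measure) \<Rightarrow> (real \<Rightarrow> 'a \<Rightarrow> real) \<Rightarrow> real \<Rightarrow>
   (real \<Rightarrow> 'a \<Rightarrow> real) \<Rightarrow> ('a \<Rightarrow> real) \<Rightarrow> bool"
where
  "is_ito_integral M F W T H J \<longleftrightarrow>
     (\<lambda>(s, \<omega>). H s \<omega>) \<in> borel_measurable (restrict_space lborel {0..T} \<Otimes>\<^sub>M M) \<and>
     J \<in> borel_measurable M \<and>
     (\<exists>n ts \<xi>.
        (\<forall>k. simple_process M F T (n k) (ts k) (\<xi> k)) \<and>
        (\<lambda>k. \<integral>\<^sup>+\<omega>. (\<integral>\<^sup>+s\<in>{0..T}. ennreal ((H s \<omega> - simple_value (n k) (ts k) (\<xi> k) s \<omega>)\<^sup>2) \<partial>lborel) \<partial>M)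
          \<longlonglongrightarrow> 0 \<and>
        (\<lambda>k. \<integral>\<^sup>+\<omega>. ennreal ((J \<omega> - simple_integral W (n k) (ts k) (\<xi> k) \<omega>)\<^sup>2) \<partial>M)
          \<longlonglongrightarrow> 0)"

definition is_ito_integral_process ::
  "'a measure \<Rightarrow> (real \<Rightarrow> 'a measure) \<Rightarrow> (real \<Rightarrow> 'a \<Rightarrow> real) \<Rightarrow>
   (real \<Rightarrow> 'a \<Rightarrow> real) \<Rightarrow> (real \<Rightarrow> 'a \<Rightarrow> real) \<Rightarrow> bool"
where
  "is_ito_integral_process M F W H I \<longleftrightarrow>
     (AE \<omega> in M. continuous_on {0..} (\<lambda>t. I t \<omega>)) \<and>
     (\<forall>t\<ge>0. is_ito_integral M F W t H (I t))"

text \<open>Positive global (strong) solution of \<open>dY = f(Y) dt + \<sigma> dW\<close>, \<open>Y 0 = y0\<close>,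
  with constant diffusion coefficient \<open>\<sigma>\<close>.\<close>

definition positive_global_solution ::
  "'a measure \<Rightarrow> (real \<Rightarrow> 'a measure) \<Rightarrow> (real \<Rightarrow> 'a \<Rightarrow> real) \<Rightarrow>
   (real \<Rightarrow> real) \<Rightarrow> real \<Rightarrow> real \<Rightarrow> (real \<Rightarrow> 'a \<Rightarrow> real) \<Rightarrow> bool"
where
  "positive_global_solution M F W f \<sigma> y0 Y \<longleftrightarrow>
     (\<forall>t\<ge>0. Y t \<in> borel_measurable (F t)) \<and>
     (AE \<omega> in M. continuous_on {0..} (\<lambda>t. Y t \<omega>)) \<and>
     (AE \<omega> in M. Y 0 \<omega> = y0) \<and>
     (AE \<omega> in M. \<forall>t\<ge>0. 0 < Y t \<omega>) \<and>
     (\<exists>I. is_ito_integral_process M F W (\<lambda>_ _. \<sigma>) I \<and>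
       (AE \<omega> in M. \<forall>t\<ge>0.
          set_integrable lborel {0..t} (\<lambda>s. f (Y s \<omega>)) \<and>
          Y t \<omega> = Y 0 \<omega> + (LBINT s:{0..t}. f (Y s \<omega>)) + I t \<omega>))"

text \<open>Drift of \<open>Y = X powr (1 - \<theta>)\<close>; only its values at \<open>x > 0\<close> matter. The argument
  \<open>am1\<close> is \<open>a\<^sub>-\<^sub>1\<close>.\<close>

definition lamperti_drift ::
  "real \<Rightarrow> real \<Rightarrow> real \<Rightarrow> real \<Rightarrow> real \<Rightarrow> real \<Rightarrow> real \<Rightarrow> real \<Rightarrow> real"
where
  "lamperti_drift am1 a0 a1 a2 b \<gamma> \<theta> x =
     (\<theta> - 1) * (a2 * x powr ((\<gamma> - \<theta>) / (1 - \<theta>)) - a1 * x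
       - am1 * x powr ((\<theta> + 1) / (\<theta> - 1)) + a0 * x powr (\<theta> / (\<theta> - 1))
       + 1 / 2 * b\<^sup>2 * \<theta> * inverse x)"

end

theory Submission
  imports Defs
begin

text \<open>The noise coefficient is constant, so for each path of \<open>W\<close> the equation is an ordinary integral equation
  \<open>Y t = y0 + \<integral> f (Y s) ds + \<sigma> * W t\<close> on the open half line. The drift is Lipschitz on compact subsets
  of \<open>{0<..}\<close>, which gives uniqueness and a solution up to the time when it leaves every compact
  subset (\<open>picard_existence\<close>, \<open>solution_unique\<close>, applied to truncated drifts). The question is
  why almost surely this time is infinite.

  Infinity is excluded path by path. For large \<open>x\<close> the \<open>am1\<close> term dominates, so the drift is bounded above on
  \<open>{1..}\<close>, and only the noise, which is bounded on bounded time intervals, can push further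
  (\<open>no_upward_explosion\<close>).

  Zero cannot be excluded path by path in general: if the \<open>a2\<close> term is weak there, the drift near zero is of
  the form \<open>c / x\<close>, on the scale of Brownian motion itself, and whether zero is reached depends on
  the constant. Here \<open>c\<close> exceeds \<open>\<sigma>\<^sup>2 / 2\<close> (\<open>lamperti_drift_repelling\<close>), so the logarithm is a Lyapunov function: by
  the Ito formula the process \<open>- ln Y\<close> has a drift that is bounded above while \<open>Y\<close> is below a level \<open>R\<close>. Hence the mean of
  \<open>- ln Y\<close> at the exit from \<open>{\<epsilon>..R}\<close> before time \<open>T\<close> is bounded independently of \<open>\<epsilon>\<close>, and reaching \<open>\<epsilon>\<close> before \<open>R\<close>
  has probability of order \<open>1 / ln (1 / \<epsilon>)\<close>.

  Ito's formula and stopping times are avoided by carrying out this argument for the Euler scheme, which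
  is a finite recursion with independent Gaussian increments. There the formula is a second-order
  Taylor bound with cubic remainder (\<open>log_barrier_taylor\<close>, \<open>log_barrier_step\<close>, \<open>euler_low_exit_prob\<close>), and the convergence of the scheme
  transfers the estimate to the solution (\<open>euler_low_exit\<close>). The same convergence makes the
  solution adapted.

  Finally, a competing solution comes with some process that is an Ito integral of the constant
  \<open>\<sigma>\<close>. The isometry for simple processes identifies it with \<open>\<sigma> * W\<close>
  (\<open>ito_integral_process_const_unique\<close>), so that competing solutions solve the same path-by-path equation.\<close>

section \<open>Integral equations driven by a continuous path\<close>

text \<open>The noise is additive, so for one fixed path \<open>w\<close> of the Brownian motion the stochastic equation is an
  ordinary integral equation, and stochastic integration enters only through Ito integrals of constants.\<close>

definition solves_upto ::
  "real \<Rightarrow> (real \<Rightarrow> real) \<Rightarrow> real \<Rightarrow> real \<Rightarrow> (real \<Rightarrow> real) \<Rightarrow> (real \<Rightarrow> real) \<Rightarrow> bool"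
where
  "solves_upto T g \<sigma> y0 w y \<longleftrightarrow>
     continuous_on {0..T} y \<and>
     (\<forall>t\<in>{0..T}. y t = y0 + integral {0..t} (\<lambda>s. g (y s)) + \<sigma> * w t)"

lemma solves_upto_cong_drift:
  assumes "solves_upto T g \<sigma> y0 w y" "\<And>t. t \<in> {0..T} \<Longrightarrow> g (y t) = f (y t)"
  shows "solves_upto T f \<sigma> y0 w y"
proof -
  have "integral {0..t} (\<lambda>s. g (y s)) = integral {0..t} (\<lambda>s. f (y s))" if "t \<in> {0..T}" for t
    by (rule integral_cong) (use assms(2) that in auto)
  with assms(1) show ?thesis by (simp add: solves_upto_def)
qed

lemma continuous_drift:
  assumes "L-lipschitz_on S g" "continuous_on {a..b} y" "y ` {a..b} \<subseteq> S"
  shows "continuous_on {a..b} (\<lambda>s. g (y s))"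
  using continuous_on_compose2[OF lipschitz_on_continuous_on[OF assms(1)] assms(2)] assms(3) by auto

text \<open>Picard iteration. Successive differences are measured against the weight \<open>exp (2 * K * t)\<close>, in which
  one application of the integral operator contracts by the factor \<open>1/2\<close>. Hence the iterates
  converge geometrically on every bounded interval and there is no need to glue short time steps.\<close>

lemma picard_existence:
  fixes g w :: "real \<Rightarrow> real"
  assumes L: "L-lipschitz_on UNIV g" and G: "\<And>x. \<bar>g x\<bar> \<le> G" and w: "continuous_on {0..} w"
  shows "\<exists>y. \<forall>T. solves_upto T g \<sigma> y0 w y"
proof -
  define K where "K = L + 1"
  have K: "K > 0" "L \<le> K" using lipschitz_on_nonneg[OF L] by (auto simp: K_def)
  have G0: "G \<ge> 0" using G[of 0] by linarith
  define p where "p = rec_nat (\<lambda>t. y0 + \<sigma> * w t)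
     (\<lambda>n q t. y0 + integral {0..t} (\<lambda>s. g (q s)) + \<sigma> * w t)"
  have p0: "p 0 t = y0 + \<sigma> * w t" for t by (simp add: p_def)
  have pS: "p (Suc n) t = y0 + integral {0..t} (\<lambda>s. g (p n s)) + \<sigma> * w t" for n t
    by (simp add: p_def)
  have w': "continuous_on {0..T} w" for T by (rule continuous_on_subset[OF w]) auto
  have pc: "continuous_on {0..T} (p n)" for n T
  proof (induction n)
    case 0 show ?case unfolding p0[abs_def] by (intro continuous_intros w')
  next
    case (Suc n)
    have "continuous_on {0..T} (\<lambda>s. g (p n s))" using Suc by (rule continuous_drift[OF L]) auto
    then have "continuous_on {0..T} (\<lambda>t. integral {0..t} (\<lambda>s. g (p n s)))"
      by (intro indefinite_integral_continuous_1 integrable_continuous_real)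
    then show ?case unfolding pS[abs_def] by (intro continuous_intros w')
  qed
  have gi: "(\<lambda>s. g (p n s)) integrable_on {0..t}" for n t
    by (intro integrable_continuous_real continuous_drift[OF L pc]) auto
  \<comment> \<open>The first difference is at most \<open>G * t\<close>, and \<open>G * t = A * (2 * K * t)\<close> is at most \<open>A * exp (2 * K * t)\<close>.\<close>
  define A where "A = G / (2 * K)"
  have A0: "A \<ge> 0" using K G0 by (simp add: A_def)
  have step: "\<bar>p (Suc n) t - p n t\<bar> \<le> A * exp (2 * K * t) * (1/2)^n" if "0 \<le> t" for n t
    using that
  proof (induction n arbitrary: t)
    case 0
    have "norm (integral {0..t} (\<lambda>s. g (p 0 s))) \<le> G * (t - 0)"
      by (intro integral_bound continuous_drift[OF L pc]) (use 0 G in auto)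
    also have "\<dots> = A * (2 * K * t)" using K by (simp add: A_def)
    also have "\<dots> \<le> A * exp (2 * K * t)"
      using A0 by (rule mult_left_mono[rotated]) (use exp_ge_add_one_self[of "2*K*t"] in linarith)
    finally show ?case by (simp add: pS p0)
  next
    case (Suc n)
    have E: "((\<lambda>s. A * exp (2 * K * s) * (1/2)^n * K) has_integral
          A * exp (2 * K * t) * (1/2)^Suc n - A * exp (2 * K * 0) * (1/2)^Suc n) {0..t}"
      by (intro fundamental_theorem_of_calculus Suc)
        (auto intro!: derivative_eq_intros simp flip: has_real_derivative_iff_has_vector_derivative)
    have "p (Suc (Suc n)) t - p (Suc n) t = integral {0..t} (\<lambda>s. g (p (Suc n) s) - g (p n s))"
      unfolding integral_diff[OF gi gi] by (subst (1) pS, subst (2) pS) simp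
    also have "norm \<dots> \<le> integral {0..t} (\<lambda>s. A * exp (2 * K * s) * (1/2)^n * K)"
    proof (rule integral_norm_bound_integral)
      show "(\<lambda>s. g (p (Suc n) s) - g (p n s)) integrable_on {0..t}" by (intro integrable_diff gi)
      show "(\<lambda>s. A * exp (2 * K * s) * (1/2)^n * K) integrable_on {0..t}" using E by blast
      fix s assume s: "s \<in> {0..t}"
      have "norm (g (p (Suc n) s) - g (p n s)) \<le> L * \<bar>p (Suc n) s - p n s\<bar>"
        using lipschitz_onD[OF L, of "p (Suc n) s" "p n s"] by (simp add: dist_norm)
      also have "\<dots> \<le> K * (A * exp (2 * K * s) * (1/2)^n)"
        by (rule mult_mono) (use K s Suc.IH[of s] in auto)
      finally show "norm (g (p (Suc n) s) - g (p n s)) \<le> A * exp (2 * K * s) * (1/2)^n * K"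
        by (simp add: mult_ac)
    qed
    also have "\<dots> \<le> A * exp (2 * K * t) * (1/2)^Suc n"
      using integral_unique[OF E] A0 by simp
    finally show ?case by simp
  qed
  define y where "y = (\<lambda>t. p 0 t + (\<Sum>i. p (Suc i) t - p i t))"
  have tele: "(\<Sum>i<n. p (Suc i) t - p i t) = p n t - p 0 t" for n t
    by (rule sum_lessThan_telescope)
  have ul: "uniform_limit {0..T} p y sequentially" for T
  proof -
    have "uniform_limit {0..T} (\<lambda>n t. \<Sum>i<n. p (Suc i) t - p i t)
        (\<lambda>t. \<Sum>i. p (Suc i) t - p i t) sequentially"
    proof (rule Weierstrass_m_test)
      show "norm (p (Suc n) t - p n t) \<le> A * exp (2 * K * T) * (1/2)^n" if "t \<in> {0..T}" for n t
      proof -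
        have "\<bar>p (Suc n) t - p n t\<bar> \<le> A * exp (2 * K * t) * (1/2)^n" using that by (intro step) auto
        also have "\<dots> \<le> A * exp (2 * K * T) * (1/2)^n"
          using A0 K that by (intro mult_right_mono mult_left_mono) auto
        finally show ?thesis by simp
      qed
      show "summable (\<lambda>n. A * exp (2 * K * T) * (1/2)^n)" by (intro summable_mult summable_geometric) auto
    qed
    then have "uniform_limit {0..T} (\<lambda>n t. p 0 t + (\<Sum>i<n. p (Suc i) t - p i t)) y sequentially"
      unfolding y_def by (intro uniform_limit_intros)
    then show ?thesis by (simp add: tele)
  qed
  have yc: "continuous_on {0..T} y" for T
    by (rule uniform_limit_theorem[OF _ ul]) (auto simp: pc)
  have eq: "y t = y0 + integral {0..t} (\<lambda>s. g (y s)) + \<sigma> * w t" if t: "t \<ge> 0" for t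
  proof -
    have lim: "(\<lambda>n. p n s) \<longlonglongrightarrow> y s" if "s \<ge> 0" for s
      by (rule tendsto_uniform_limitI[OF ul[of s]]) (use that in auto)
    have "uniform_limit {0..t} (\<lambda>n s. g (p n s)) (\<lambda>s. g (y s)) sequentially"
    proof (rule uniform_limit_compose_uniformly_continuous_on[OF ul[of t]])
      show "uniformly_continuous_on UNIV g" by (rule lipschitz_on_uniformly_continuous[OF L])
    qed auto
    then obtain I J where IJ: "\<And>n. ((\<lambda>s. g (p n s)) has_integral I n) {0..t}"
       "((\<lambda>s. g (y s)) has_integral J) {0..t}" "I \<longlonglongrightarrow> J"
      by (rule uniform_limit_integral) (auto intro!: continuous_drift[OF L pc])
    have "(\<lambda>n. p (Suc n) t) \<longlonglongrightarrow> y0 + J + \<sigma> * w t"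
      unfolding pS integral_unique[OF IJ(1)] by (intro tendsto_intros IJ)
    moreover have "(\<lambda>n. p (Suc n) t) \<longlonglongrightarrow> y t" using lim[OF t] by (rule LIMSEQ_Suc)
    ultimately show ?thesis using IJ(2) LIMSEQ_unique by (metis integral_unique)
  qed
  show ?thesis unfolding solves_upto_def
    by (intro exI[of _ y] allI conjI ballI yc) (rule eq, simp)
qed

text \<open>The noise cancels in the difference \<open>D\<close> of two solutions, so \<open>D\<close> is differentiable although
  the solutions are not, and \<open>D\<^sup>2 * exp (- 2 * L * t)\<close> is nonincreasing from the value \<open>0\<close>.
  Only the values in \<open>S\<close> matter, so this also serves for drifts that are Lipschitz merely on compact
  subsets of the half line.\<close>

lemma solution_unique:
  assumes L: "L-lipschitz_on S g"
    and y: "solves_upto T g \<sigma> y0 w y" "y ` {0..T} \<subseteq> S"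
    and z: "solves_upto T g \<sigma> y0 w z" "z ` {0..T} \<subseteq> S"
    and t: "t \<in> {0..T}"
  shows "y t = z t"
proof -
  define D where "D = (\<lambda>t. integral {0..t} (\<lambda>s. g (y s) - g (z s)))"
  have c: "continuous_on {0..T} (\<lambda>s. g (y s))" "continuous_on {0..T} (\<lambda>s. g (z s))"
    using y z by (auto intro!: continuous_drift[OF L] simp: solves_upto_def)
  have i: "(\<lambda>s. g (y s)) integrable_on {0..u}" "(\<lambda>s. g (z s)) integrable_on {0..u}" if "u \<in> {0..T}" for u
    using that by (auto intro!: integrable_continuous_real continuous_on_subset[OF c(1)] continuous_on_subset[OF c(2)])
  have D: "D u = y u - z u" if "u \<in> {0..T}" for u
    using y(1) z(1) that i[OF that] by (auto simp: D_def solves_upto_def integral_diff)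
  have D': "(D has_real_derivative (g (y u) - g (z u))) (at u within {0..T})" if "u \<in> {0..T}" for u
    unfolding D_def using that by (intro integral_has_real_derivative continuous_intros c)
  define E where "E = (\<lambda>u. (D u)\<^sup>2 * exp (- 2 * L * u))"
  have "E t \<le> E 0"
  proof (rule DERIV_nonpos_imp_decreasing_open[of 0 t E])
    show "0 \<le> t" using t by auto
    show "continuous_on {0..t} E" unfolding E_def
      using t by (intro continuous_intros continuous_on_subset[OF DERIV_continuous_on[OF D']]) auto
    fix u assume u: "0 < u" "u < t"
    have uT: "u \<in> {0..T}" "u \<in> interior {0..T}" using u t by auto
    have "(D has_real_derivative (g (y u) - g (z u))) (at u)"
      using D'[OF uT(1)] at_within_interior[OF uT(2)] by simp
    then have "(E has_real_derivative (2 * D u * (g (y u) - g (z u)) - 2 * L * (D u)\<^sup>2) * exp (- 2 * L * u)) (at u)"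
      unfolding E_def by (auto intro!: derivative_eq_intros simp: algebra_simps)
    moreover have "2 * D u * (g (y u) - g (z u)) - 2 * L * (D u)\<^sup>2 \<le> 0"
    proof -
      have "\<bar>g (y u) - g (z u)\<bar> \<le> L * \<bar>D u\<bar>"
        using lipschitz_onD[OF L, of "y u" "z u"] image_subset_iff[THEN iffD1, OF y(2)]
          image_subset_iff[THEN iffD1, OF z(2)] uT(1) by (simp add: dist_norm D)
      then have "\<bar>D u\<bar> * \<bar>g (y u) - g (z u)\<bar> \<le> \<bar>D u\<bar> * (L * \<bar>D u\<bar>)" by (rule mult_left_mono) auto
      moreover have "D u * (g (y u) - g (z u)) \<le> \<bar>D u\<bar> * \<bar>g (y u) - g (z u)\<bar>"
        by (metis abs_ge_self abs_mult)
      ultimately show ?thesis by (simp add: power2_eq_square algebra_simps abs_mult_self_eq)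
    qed
    ultimately show "\<exists>d. DERIV E u :> d \<and> d \<le> 0"
      by (metis (no_types) exp_ge_zero mult_nonpos_nonneg)
  qed
  also have "E 0 = 0" by (simp add: E_def D_def)
  finally have "D t = 0" unfolding E_def
    by (smt (verit) exp_gt_zero mult_pos_pos zero_less_power2)
  with D[OF t] show ?thesis by simp
qed

section \<open>The Euler scheme, stopped outside a set\<close>

text \<open>The scheme is frozen from the first time it is outside \<open>S\<close>. With \<open>S = UNIV\<close> it approximates the
  solution and shows that the solution depends measurably on the path; with a bounded interval
  \<open>S\<close> it is the process whose exit probabilities are estimated.\<close>

primrec euler ::
  "(real \<Rightarrow> real) \<Rightarrow> real set \<Rightarrow> real \<Rightarrow> real \<Rightarrow> real \<Rightarrow> (real \<Rightarrow> real) \<Rightarrow> nat \<Rightarrow> real"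
where
  "euler g S \<sigma> y0 h w 0 = y0"
| "euler g S \<sigma> y0 h w (Suc k) = euler g S \<sigma> y0 h w k +
     (if euler g S \<sigma> y0 h w k \<in> S
      then g (euler g S \<sigma> y0 h w k) * h + \<sigma> * (w (real (Suc k) * h) - w (real k * h)) else 0)"

lemma euler_frozen:
  assumes "euler g S \<sigma> y0 h w k \<notin> S" "k \<le> n"
  shows "euler g S \<sigma> y0 h w n = euler g S \<sigma> y0 h w k"
  using assms(2,1) by (induction n rule: dec_induct) auto

text \<open>Discrete Gronwall estimate. The increments of the path enter the scheme exactly, so the only error
  made in one step is that of freezing the drift, at most \<open>L * h\<close> times the present error plus the
  oscillation \<open>\<delta>\<close> of the solution. The estimate holds up to and including the step in which
  the scheme leaves \<open>S\<close>, which is what exit arguments need.\<close>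

lemma euler_error:
  assumes L: "L-lipschitz_on UNIV g"
    and y: "solves_upto T g \<sigma> y0 w y" and w0: "w 0 = 0" and h: "h \<ge> 0"
    and \<delta>: "\<And>r s. r \<in> {0..T} \<Longrightarrow> s \<in> {0..T} \<Longrightarrow> \<bar>r - s\<bar> \<le> h \<Longrightarrow> \<bar>y r - y s\<bar> \<le> \<delta>"
    and k: "real k * h \<le> T" and S: "\<And>j. j < k \<Longrightarrow> euler g S \<sigma> y0 h w j \<in> S"
  shows "\<bar>euler g S \<sigma> y0 h w k - y (real k * h)\<bar> \<le> \<delta> * exp (L * T)"
proof -
  let ?z = "euler g S \<sigma> y0 h w"
  have L0: "L \<ge> 0" using lipschitz_on_nonneg[OF L] .
  have T0: "T \<ge> 0" using k h by (smt (verit) mult_nonneg_nonneg of_nat_0_le_iff)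
  have \<delta>0: "\<delta> \<ge> 0" using \<delta>[of 0 0] T0 h by auto
  have yeq: "y t = y0 + integral {0..t} (\<lambda>s. g (y s)) + \<sigma> * w t" if "t \<in> {0..T}" for t
    using y that by (auto simp: solves_upto_def)
  have gi: "(\<lambda>s. g (y s)) integrable_on {a..b}" if "0 \<le> a" "b \<le> T" for a b
    using y that by (intro integrable_continuous_real continuous_drift[OF L])
      (auto simp: solves_upto_def elim!: continuous_on_subset)
  have "\<bar>?z k - y (real k * h)\<bar> \<le> \<delta> * ((1 + L * h) ^ k - 1)" using k S
  proof (induction k)
    case 0
    then show ?case using yeq[of 0] T0 w0 by simp
  next
    case (Suc k)
    define a b where "a = real k * h" and "b = real (Suc k) * h"
    have ab: "0 \<le> a" "a \<le> b" "b \<le> T" "b - a = h" using h Suc.prems(1)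
      by (auto simp: a_def b_def algebra_simps)
    have IH: "\<bar>?z k - y a\<bar> \<le> \<delta> * ((1 + L * h) ^ k - 1)"
      unfolding a_def using Suc.prems ab by (intro Suc.IH) (auto simp: a_def)
    have "y b - y a = integral {a..b} (\<lambda>s. g (y s)) + \<sigma> * (w b - w a)"
      using yeq[of a] yeq[of b] ab
        Henstock_Kurzweil_Integration.integral_combine[of 0 a b "\<lambda>s. g (y s)"] gi[of 0 b]
      by (simp add: algebra_simps)
    moreover have "?z (Suc k) = ?z k + g (?z k) * h + \<sigma> * (w b - w a)"
      using Suc.prems(2)[of k] by (simp add: a_def b_def)
    moreover have "integral {a..b} (\<lambda>s. g (?z k) - g (y s)) = g (?z k) * h - integral {a..b} (\<lambda>s. g (y s))"
      using ab gi[of a b] by (subst integral_diff) auto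
    moreover have "norm (integral {a..b} (\<lambda>s. g (?z k) - g (y s))) \<le>
        L * (\<delta> * ((1 + L * h) ^ k - 1) + \<delta>) * (b - a)"
    proof (rule integral_bound)
      show "continuous_on {a..b} (\<lambda>s. g (?z k) - g (y s))"
        using y ab by (intro continuous_intros continuous_drift[OF L])
          (auto simp: solves_upto_def elim!: continuous_on_subset)
      fix s assume s: "s \<in> {a..b}"
      have "\<bar>y a - y s\<bar> \<le> \<delta>" using s ab by (intro \<delta>) auto
      then have "\<bar>?z k - y s\<bar> \<le> \<delta> * ((1 + L * h) ^ k - 1) + \<delta>" using IH by linarith
      then show "norm (g (?z k) - g (y s)) \<le> L * (\<delta> * ((1 + L * h) ^ k - 1) + \<delta>)"
        using lipschitz_onD[OF L, of "?z k" "y s"] L0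
        by (smt (verit) UNIV_I dist_real_def mult_left_mono real_norm_def)
    qed (use ab in auto)
    note this[unfolded ab(4)]
    ultimately have "\<bar>?z (Suc k) - y b\<bar> \<le> \<delta> * ((1 + L * h) ^ k - 1) + L * (\<delta> * ((1 + L * h) ^ k - 1) + \<delta>) * h"
      using IH unfolding real_norm_def by linarith
    also have "\<dots> = \<delta> * ((1 + L * h) ^ Suc k - 1)" by (simp add: algebra_simps)
    finally show ?case by (simp add: b_def)
  qed
  also have "(1 + L * h) ^ k \<le> exp (L * h) ^ k"
    using L0 h by (intro power_mono) (auto simp: exp_ge_add_one_self)
  also have "exp (L * h) ^ k = exp (L * (real k * h))"
    by (simp flip: exp_of_nat_mult add: mult_ac)
  also have "\<dots> \<le> exp (L * T)" using L0 k by (simp add: mult_left_mono)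
  finally show ?thesis using \<delta>0 by (smt (verit) mult_left_mono)
qed

lemma fine_mesh:
  assumes y: "continuous_on {0..T} y" and "T \<ge> 0" "\<delta> > 0"
  shows "\<forall>\<^sub>F n in sequentially. \<forall>r\<in>{0..T}. \<forall>s\<in>{0..T}.
     \<bar>r - s\<bar> \<le> T / real (Suc n) \<longrightarrow> \<bar>y r - y s :: real\<bar> \<le> \<delta>"
proof -
  have "uniformly_continuous_on {0..T} y" by (intro compact_uniformly_continuous y) auto
  then obtain d where d: "d > 0" "\<And>r s. r \<in> {0..T} \<Longrightarrow> s \<in> {0..T} \<Longrightarrow> dist s r < d \<Longrightarrow> dist (y s) (y r) < \<delta>"
    unfolding uniformly_continuous_on_def using assms(3) by metis
  have "(\<lambda>n. T / real (Suc n)) \<longlonglongrightarrow> 0"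
    using LIMSEQ_Suc[OF lim_const_over_n[of T]] by simp
  then have "\<forall>\<^sub>F n in sequentially. T / real (Suc n) < d" using d(1) by (rule order_tendstoD)
  then show ?thesis
    by eventually_elim (use d(2) in \<open>force simp: dist_real_def abs_minus_commute\<close>)
qed

lemma euler_tendsto:
  assumes L: "L-lipschitz_on UNIV g"
    and y: "solves_upto T g \<sigma> y0 w y" and w0: "w 0 = 0" and T: "T \<ge> 0"
  shows "(\<lambda>n. euler g UNIV \<sigma> y0 (T / real (Suc n)) w (Suc n)) \<longlonglongrightarrow> y T"
proof (rule tendstoI)
  fix e :: real assume e: "e > 0"
  define \<delta> where "\<delta> = e / (2 * exp (L * T))"
  have \<delta>: "\<delta> > 0" "\<delta> * exp (L * T) < e" using e by (auto simp: \<delta>_def)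
  have "continuous_on {0..T} y" using y by (simp add: solves_upto_def)
  from fine_mesh[OF this T \<delta>(1)]
  show "\<forall>\<^sub>F n in sequentially. dist (euler g UNIV \<sigma> y0 (T / real (Suc n)) w (Suc n)) (y T) < e"
  proof eventually_elim
    case (elim n)
    have "\<bar>euler g UNIV \<sigma> y0 (T / real (Suc n)) w (Suc n) - y (real (Suc n) * (T / real (Suc n)))\<bar>
        \<le> \<delta> * exp (L * T)"
      by (rule euler_error[OF L y w0]) (use elim T in auto)
    then show ?case using \<delta>(2) by (simp add: dist_real_def)
  qed
qed

text \<open>If the solution dips strictly below \<open>\<epsilon>\<close> while staying below \<open>R\<close>, a fine scheme cannot remain in
  \<open>{\<epsilon>..R+1}\<close> up to that dip, and the margin of \<open>1\<close> prevents it from leaving through the top.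
  So it leaves through the bottom and stays there. This turns a statement about the
  path into one about countably many random variables.\<close>

lemma euler_low_exit:
  assumes L: "L-lipschitz_on UNIV g"
    and y: "solves_upto T g \<sigma> y0 w y" and w0: "w 0 = 0"
    and R: "\<And>t. t \<in> {0..T} \<Longrightarrow> y t \<le> R" and low: "t \<in> {0..T}" "y t < \<epsilon>" and T: "T > 0"
  shows "\<forall>\<^sub>F n in sequentially. euler g {\<epsilon>..R+1} \<sigma> y0 (T / real (Suc n)) w (Suc n) < \<epsilon>"
proof -
  \<comment> \<open>The dip has depth at least \<open>e\<close>; the scheme error and the distance of the dip from the nearest
    earlier grid point may each use up a third of it.\<close>
  define e where "e = min 1 (\<epsilon> - y t)"
  define \<delta> where "\<delta> = e / (3 * exp (L * T))"
  have e: "e > 0" "e \<le> 1" "e \<le> \<epsilon> - y t" using low by (auto simp: e_def)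
  have L0: "L * T \<ge> 0" using lipschitz_on_nonneg[OF L] T by simp
  have "1 \<le> exp (L * T)" using L0 by simp
  then have "\<delta> \<le> e / 3" using e unfolding \<delta>_def by (intro divide_left_mono) auto
  then have \<delta>: "\<delta> > 0" "\<delta> * exp (L * T) = e / 3" "\<delta> \<le> e / 3" using e by (auto simp: \<delta>_def)
  have "continuous_on {0..T} y" using y by (simp add: solves_upto_def)
  from fine_mesh[OF this less_imp_le[OF T] \<delta>(1)]
  show ?thesis
  proof eventually_elim
    case (elim n)
    define h where "h = T / real (Suc n)"
    have h: "h > 0" "real (Suc n) * h = T" using T by (auto simp: h_def)
    let ?z = "euler g {\<epsilon>..R+1} \<sigma> y0 h w"
    have err: "\<bar>?z k - y (real k * h)\<bar> \<le> e / 3" if "k \<le> Suc n" "\<And>j. j < k \<Longrightarrow> ?z j \<in> {\<epsilon>..R+1}" for k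
      unfolding \<delta>(2)[symmetric]
    proof (rule euler_error[OF L y w0 _ _ _ that(2)])
      have "real k * h \<le> real (Suc n) * h" using that(1) h(1) by (intro mult_right_mono) auto
      then show "real k * h \<le> T" unfolding h(2) .
    qed (use elim h in \<open>auto simp: h_def\<close>)
    have grid: "real k * h \<in> {0..T}" if "k \<le> Suc n" for k
      using that h by (metis atLeastAtMost_iff less_imp_le mult_nonneg_nonneg mult_right_mono of_nat_0_le_iff of_nat_le_iff)
    define k where "k = nat \<lfloor>t / h\<rfloor>"
    have th: "t / h \<ge> 0" using low h by simp
    have k1: "real k \<le> t / h" "t / h < real k + 1" using th by (auto simp: k_def)
    have kt: "real k * h \<le> t" "t - real k * h \<le> h" using k1 h(1) by (auto simp: field_simps)
    have kn: "k \<le> Suc n"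
    proof -
      have "real k * h \<le> real (Suc n) * h" using kt(1) low(1) h(2) by simp
      then show ?thesis using h(1) by simp
    qed
    have "y (real k * h) \<le> y t + \<delta>"
      using elim grid[OF kn] low(1) kt unfolding h_def[symmetric] by (smt (verit))
    then have yk: "y (real k * h) \<le> y t + e / 3" using \<delta>(3) by linarith
    have "\<exists>j\<le>k. ?z j \<notin> {\<epsilon>..R+1}"
    proof (rule ccontr)
      assume "\<not> ?thesis"
      then have "?z k \<ge> \<epsilon>" "\<bar>?z k - y (real k * h)\<bar> \<le> e / 3" using err[OF kn] by auto
      then show False using yk e by linarith
    qed
    then have ex: "\<exists>j. ?z j \<notin> {\<epsilon>..R+1}" by blast
    define j where "j = (LEAST j. ?z j \<notin> {\<epsilon>..R+1})"
    have j: "j \<le> k" "?z j \<notin> {\<epsilon>..R+1}" "\<And>i. i < j \<Longrightarrow> ?z i \<in> {\<epsilon>..R+1}"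
      unfolding j_def using \<open>\<exists>j\<le>k. _\<close> LeastI_ex[OF ex]
      by (auto intro: order_trans[OF Least_le] dest: not_less_Least simp del: atLeastAtMost_iff)
    have "\<bar>?z j - y (real j * h)\<bar> \<le> e / 3" using j kn by (intro err) auto
    moreover have "y (real j * h) \<le> R" using j(1) kn by (intro R grid) auto
    ultimately have "?z j < \<epsilon>" using j(2) e(2) by auto
    with euler_frozen[OF j(2), of "Suc n"] j(1) kn show ?case by (simp add: h_def)
  qed
qed

section \<open>A logarithmic Lyapunov function\<close>

text \<open>For \<open>x \<ge> 0\<close> the quadratic bound holds by itself. The cubic term pays for
  negative \<open>x\<close>, as long as the singularity at \<open>-1\<close> is kept away.\<close>

lemma ln_cubic_lower_bound:
  fixes x :: real
  assumes "x > - 1/2"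
  shows "x - x\<^sup>2 / 2 - \<bar>x\<bar>^3 \<le> ln (1 + x)"
proof (cases "x \<ge> 0")
  case True
  define \<phi> where "\<phi> = (\<lambda>x::real. ln (1 + x) - x + x\<^sup>2 / 2)"
  have "\<phi> 0 \<le> \<phi> x"
  proof (rule DERIV_nonneg_imp_nondecreasing[OF True])
    fix u :: real assume u: "0 \<le> u" "u \<le> x"
    have "DERIV \<phi> u :> 1 / (1 + u) - 1 + u"
      unfolding \<phi>_def using u by (auto intro!: derivative_eq_intros)
    moreover have "1 / (1 + u) - 1 + u = u\<^sup>2 / (1 + u)" using u by (simp add: field_simps power2_eq_square)
    ultimately show "\<exists>d. DERIV \<phi> u :> d \<and> 0 \<le> d" using u by (metis add_nonneg_nonneg divide_nonneg_nonneg zero_le_one zero_le_power2)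
  qed
  moreover have "0 \<le> \<bar>x\<bar>^3" "\<phi> 0 = 0" by (simp_all add: \<phi>_def)
  ultimately show ?thesis unfolding \<phi>_def by linarith
next
  case False
  define \<phi> where "\<phi> = (\<lambda>x::real. ln (1 + x) - x + x\<^sup>2 / 2 - x^3)"
  have "\<phi> x \<ge> \<phi> 0"
  proof (rule DERIV_nonpos_imp_nonincreasing[of x 0 \<phi>])
    show "x \<le> 0" using False by simp
    fix u :: real assume u: "x \<le> u" "u \<le> 0"
    have p: "1 + u > 1/2" using u assms by linarith
    have "DERIV \<phi> u :> 1 / (1 + u) - 1 + u - 3 * u\<^sup>2"
      unfolding \<phi>_def using p by (auto intro!: derivative_eq_intros)
    moreover have "1 / (1 + u) - 1 + u = u\<^sup>2 * (1 / (1 + u))" using p by (simp add: field_simps power2_eq_square)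
    moreover have "1 / (1 + u) \<le> 3" using p by (simp add: field_simps)
    then have "u\<^sup>2 * (1 / (1 + u)) \<le> u\<^sup>2 * 3" by (rule mult_left_mono) auto
    ultimately show "\<exists>d. DERIV \<phi> u :> d \<and> d \<le> 0" by (intro exI[of _ "1 / (1 + u) - 1 + u - 3 * u\<^sup>2"]) auto
  qed
  then show ?thesis using False by (simp add: \<phi>_def power3_eq_cube abs_if)
qed

text \<open>This is \<open>ln ((R + 1) / x)\<close> made bounded by clamping \<open>x\<close> to \<open>{\<epsilon>..R + 1}\<close>. It takes its maximum below
  \<open>\<epsilon>\<close>, and this maximum grows without bound as \<open>\<epsilon>\<close> tends to \<open>0\<close>.\<close>

definition log_barrier :: "real \<Rightarrow> real \<Rightarrow> real \<Rightarrow> real" where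
  "log_barrier \<epsilon> R x = ln ((R + 1) / max \<epsilon> (min x (R + 1)))"

lemma log_barrier_bounds:
  assumes "0 < \<epsilon>" "\<epsilon> \<le> R"
  shows "0 \<le> log_barrier \<epsilon> R x" "log_barrier \<epsilon> R x \<le> ln ((R + 1) / \<epsilon>)"
proof -
  have m: "\<epsilon> \<le> max \<epsilon> (min x (R + 1))" "max \<epsilon> (min x (R + 1)) \<le> R + 1" using assms by auto
  show "0 \<le> log_barrier \<epsilon> R x" unfolding log_barrier_def using m assms
    by (intro ln_ge_zero) (auto simp: field_simps simp del: max.bounded_iff)
  show "log_barrier \<epsilon> R x \<le> ln ((R + 1) / \<epsilon>)" unfolding log_barrier_def using m assms
    by (subst ln_le_cancel_iff) (auto intro!: divide_pos_pos divide_left_mono mult_pos_pos simp del: max.bounded_iff)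
qed

text \<open>The second-order Taylor bound of \<open>- ln\<close> holds for increments of any size, because the clamping is
  harmless: small \<open>d\<close> see the logarithm itself, a large downward \<open>d\<close> meets the constant maximum
  and costs no more than the cubic term, and reaching the zero plateau above \<open>R + 1\<close> needs
  \<open>d \<ge> 1\<close>. That last point is the reason for clamping at \<open>R + 1\<close> and not at \<open>R\<close>, where the kink
  would be visible from inside the interval.\<close>

lemma log_barrier_taylor:
  assumes "0 < \<epsilon>" "\<epsilon> \<le> y" "y \<le> R"
  shows "log_barrier \<epsilon> R (y + d) \<le> log_barrier \<epsilon> R y - d / y + d\<^sup>2 / (2 * y\<^sup>2)
    + (8 * ln ((R + 1) / \<epsilon>) / \<epsilon>^3 + 1 + 1 / \<epsilon>^3) * \<bar>d\<bar>^3"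
proof -
  define K where "K = ln ((R + 1) / \<epsilon>)"
  note b = log_barrier_bounds[of \<epsilon> R, folded K_def]
  have K0: "K \<ge> 0" using b[of 0] assms by linarith
  have y: "y > 0" using assms by simp
  have Vy: "log_barrier \<epsilon> R y = ln ((R + 1) / y)" using assms by (simp add: log_barrier_def)
  define A where "A = 8 * K / \<epsilon>^3 + 1 + 1 / \<epsilon>^3"
  have A: "A \<ge> 8 * K / \<epsilon>^3" "A \<ge> 1" "A \<ge> 1 / \<epsilon>^3" using assms K0 by (auto simp: A_def)
  have d3: "\<bar>d\<bar>^3 \<ge> 0" by simp
  have sq: "d\<^sup>2 / (2 * y\<^sup>2) = (d / y)\<^sup>2 / 2" by (simp add: power_divide)
  consider "d \<le> - y / 2" | "d > - y / 2" "y + d \<le> R + 1" | "y + d > R + 1" by linarith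
  then have "log_barrier \<epsilon> R (y + d) \<le> log_barrier \<epsilon> R y - d / y + d\<^sup>2 / (2 * y\<^sup>2) + A * \<bar>d\<bar>^3"
  proof cases
    case 1
    have "\<epsilon> / 2 \<le> \<bar>d\<bar>" using 1 assms by linarith
    then have "(\<epsilon> / 2)^3 \<le> \<bar>d\<bar>^3" using assms by (intro power_mono) auto
    then have "8 * K / \<epsilon>^3 * (\<epsilon> / 2)^3 \<le> A * \<bar>d\<bar>^3" using A assms K0 by (intro mult_mono) auto
    also have "8 * K / \<epsilon>^3 * (\<epsilon> / 2)^3 = K" using assms by (simp add: field_simps)
    finally have "K \<le> A * \<bar>d\<bar>^3" .
    moreover have "d / y \<le> 0" using 1 y by (intro divide_nonpos_pos) auto
    moreover have "0 \<le> d\<^sup>2 / (2 * y\<^sup>2)" by simp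
    ultimately show ?thesis using b(2)[of "y + d"] b(1)[of y] assms by linarith
  next
    case 2
    have p: "y + d > 0" using 2 y by linarith
    have "log_barrier \<epsilon> R (y + d) \<le> ln ((R + 1) / (y + d))"
      unfolding log_barrier_def using 2 p assms
      by (subst ln_le_cancel_iff) (auto intro!: divide_pos_pos divide_left_mono mult_pos_pos)
    also have "\<dots> = ln ((R + 1) / y) - ln (1 + d / y)"
    proof -
      have "1 + d / y = (y + d) / y" using y by (simp add: field_simps)
      then show ?thesis using y p assms by (simp add: ln_div)
    qed
    finally have *: "log_barrier \<epsilon> R (y + d) \<le> log_barrier \<epsilon> R y - ln (1 + d / y)" using Vy by simp
    have "d / y > - 1/2" using 2 y by (simp add: field_simps)
    from ln_cubic_lower_bound[OF this] have "d / y - (d / y)\<^sup>2 / 2 - \<bar>d / y\<bar>^3 \<le> ln (1 + d / y)" .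
    moreover have "\<bar>d / y\<bar>^3 \<le> A * \<bar>d\<bar>^3"
    proof -
      have "1 / y^3 \<le> 1 / \<epsilon>^3" using assms by (intro divide_left_mono power_mono mult_pos_pos) auto
      then have "1 / y^3 * \<bar>d\<bar>^3 \<le> A * \<bar>d\<bar>^3" using A d3 by (intro mult_right_mono) auto
      then show ?thesis using y by (simp add: power_divide abs_divide)
    qed
    ultimately show ?thesis using * sq by linarith
  next
    case 3
    have "d \<ge> 1" using 3 assms by linarith
    then have "1 \<le> \<bar>d\<bar>^3" by (intro one_le_power) auto
    then have "1 * 1 \<le> A * \<bar>d\<bar>^3" using A by (intro mult_mono) auto
    moreover have "log_barrier \<epsilon> R (y + d) = 0" using 3 assms by (simp add: log_barrier_def)
    moreover have "(d / y)\<^sup>2 - 2 * (d / y) + 1 \<ge> 0"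
      using zero_le_power2[of "d / y - 1"] by (simp add: power2_eq_square algebra_simps)
    ultimately show ?thesis using b(1)[of y] assms sq by linarith
  qed
  then show ?thesis by (simp add: A_def K_def)
qed

section \<open>Moments of Brownian increments\<close>

lemma (in brownian_motion) measurable_F: "0 \<le> t \<Longrightarrow> X \<in> borel_measurable (F t) \<Longrightarrow> X \<in> borel_measurable M"
  using subalg by (rule measurable_from_subalg)

lemma (in brownian_motion) measurable_F_mono:
  assumes "X \<in> borel_measurable (F s)" "0 \<le> s" "s \<le> t"
  shows "X \<in> borel_measurable (F t)"
proof (rule measurable_from_subalg[OF _ assms(1)])
  show "subalgebra (F t) (F s)"
    using subalg[of s] subalg[of t] mono_F[of s t] assms by (auto simp: subalgebra_def)
qed

lemma (in brownian_motion) measurable_W [measurable]: "0 \<le> t \<Longrightarrow> W t \<in> borel_measurable M"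
  using adapted_W measurable_F by blast

lemma (in brownian_motion) indep_incr_var:
  assumes "0 \<le> s" "s < t" and X: "X \<in> borel_measurable (F s)"
  shows "indep_var borel X borel (\<lambda>\<omega>. W t \<omega> - W s \<omega>)"
proof -
  let ?D = "\<lambda>\<omega>. W t \<omega> - W s \<omega>"
  have sp: "space (F s) = space M" using subalg[OF assms(1)] by (simp add: subalgebra_def)
  have "indep_set (sigma_sets (space M) (sets (F s)))
    (sigma_sets (space M) {?D -` A \<inter> space M | A. A \<in> sets borel})"
  proof (rule indep_set_sigma_sets[OF indep_incr[OF assms(1,2)]])
    show "Int_stable (sets (F s))" by (auto simp: Int_stable_def)
    show "Int_stable {?D -` A \<inter> space M | A. A \<in> sets borel}"
      unfolding Int_stable_def
    proof safe
      fix A B :: "real set" assume "A \<in> sets borel" "B \<in> sets borel"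
      then show "\<exists>C. ?D -` A \<inter> space M \<inter> (?D -` B \<inter> space M) = ?D -` C \<inter> space M \<and> C \<in> sets borel"
        by (intro exI[of _ "A \<inter> B"]) auto
    qed
  qed
  moreover have "sigma_sets (space M) {X -` A \<inter> space M | A. A \<in> sets borel} \<subseteq> sigma_sets (space M) (sets (F s))"
    using measurable_sets[OF X] sp by (intro sigma_sets_mono') auto
  ultimately have "indep_set (sigma_sets (space M) {X -` A \<inter> space M | A. A \<in> sets borel})
    (sigma_sets (space M) {?D -` A \<inter> space M | A. A \<in> sets borel})"
    unfolding indep_sets2_eq by blast
  then show ?thesis unfolding indep_var_eq
    using measurable_F[OF assms(1) X] assms by auto
qed

text \<open>The third absolute moment is needed only up to a constant: it shows that the cubic Taylor
  remainder is of smaller order than the time step.\<close>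

lemma (in brownian_motion) incr_moments:
  assumes st: "0 \<le> s" "s < t"
  defines "D \<equiv> \<lambda>\<omega>. W t \<omega> - W s \<omega>"
  shows "integrable M (\<lambda>\<omega>. D \<omega> ^ k)" "integrable M (\<lambda>\<omega>. \<bar>D \<omega>\<bar> ^ k)"
    and "expectation D = 0" "expectation (\<lambda>\<omega>. (D \<omega>)\<^sup>2) = t - s"
    and "expectation (\<lambda>\<omega>. \<bar>D \<omega>\<bar> ^ 3) \<le> 2 * ((t - s) * sqrt (t - s))"
proof -
  note D = normal_incr[OF st, folded D_def]
  have p: "0 < sqrt (t - s)" using st by simp
  have int: "expectation (\<lambda>\<omega>. g (D \<omega>)) = (\<integral>x. normal_density 0 (sqrt (t - s)) x * g x \<partial>lborel)"
    if "g \<in> borel_measurable borel" for g :: "real \<Rightarrow> real"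
    using distributed_integral[OF D, of g] that by simp
  show "integrable M (\<lambda>\<omega>. D \<omega> ^ k)" "integrable M (\<lambda>\<omega>. \<bar>D \<omega>\<bar> ^ k)"
    using distributed_integrable[OF D, of "\<lambda>x. x ^ k"] distributed_integrable[OF D, of "\<lambda>x. \<bar>x\<bar> ^ k"]
      integrable_normal_moment[OF p, of 0 k] integrable_normal_moment_abs[OF p, of 0 k] by simp_all
  show "expectation D = 0" using int[of "\<lambda>x. x"] integral_normal_moment_odd[OF p, of 0 0] by simp
  show "expectation (\<lambda>\<omega>. (D \<omega>)\<^sup>2) = t - s"
    using int[of "\<lambda>x. x^2"] integral_normal_moment_even[OF p, of 0 1] st by simp
  have "expectation (\<lambda>\<omega>. \<bar>D \<omega>\<bar> ^ 3) = 2 * sqrt (t - s) ^ 3 * sqrt (2 / pi)"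
    using int[of "\<lambda>x. \<bar>x\<bar>^3"] integral_normal_moment_abs_odd[OF p, of 0 1] by (simp add: numeral_3_eq_3)
  also have "\<dots> \<le> 2 * sqrt (t - s) ^ 3 * 1"
    using st pi_gt3 by (intro mult_left_mono) auto
  also have "\<dots> = 2 * ((t - s) * sqrt (t - s))" using st by (simp add: power3_eq_cube)
  finally show "expectation (\<lambda>\<omega>. \<bar>D \<omega>\<bar> ^ 3) \<le> 2 * ((t - s) * sqrt (t - s))" .
qed

lemma (in brownian_motion) expectation_mult_incr:
  assumes st: "0 \<le> s" "s < t" and X: "X \<in> borel_measurable (F s)" "integrable M X"
  defines "D \<equiv> \<lambda>\<omega>. W t \<omega> - W s \<omega>"
  shows "integrable M (\<lambda>\<omega>. X \<omega> * D \<omega>)" "expectation (\<lambda>\<omega>. X \<omega> * D \<omega>) = 0"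
    and "integrable M (\<lambda>\<omega>. X \<omega> * (D \<omega>)\<^sup>2)" "expectation (\<lambda>\<omega>. X \<omega> * (D \<omega>)\<^sup>2) = (t - s) * expectation X"
proof -
  have D: "W t \<omega> - W s \<omega> = D \<omega>" for \<omega> by (simp add: D_def)
  note m = incr_moments[OF st, unfolded D]
  note I = indep_incr_var[OF st X(1), unfolded D]
  have I2: "indep_var borel X borel (\<lambda>\<omega>. (D \<omega>)\<^sup>2)"
    using indep_var_compose[OF I, of "\<lambda>x. x" borel "\<lambda>x. x\<^sup>2" borel] by (simp add: comp_def)
  show "integrable M (\<lambda>\<omega>. X \<omega> * D \<omega>)"
    using indep_var_integrable[OF I X(2)] m(1)[of 1] unfolding power_one_right by blast
  show "expectation (\<lambda>\<omega>. X \<omega> * D \<omega>) = 0"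
    using indep_var_lebesgue_integral[OF I X(2)] m(1)[of 1] m(3) unfolding power_one_right by simp
  show "integrable M (\<lambda>\<omega>. X \<omega> * (D \<omega>)\<^sup>2)"
    using indep_var_integrable[OF I2 X(2)] m(1)[of 2] by simp
  show "expectation (\<lambda>\<omega>. X \<omega> * (D \<omega>)\<^sup>2) = (t - s) * expectation X"
    using indep_var_lebesgue_integral[OF I2 X(2)] m(1)[of 2] m(4) by simp
qed

section \<open>The Euler scheme rarely leaves through the bottom\<close>

lemma cube_sum_le:
  fixes a b :: real
  assumes "a \<ge> 0" "b \<ge> 0"
  shows "(a + b)^3 \<le> 4 * (a^3 + b^3)"
proof -
  have "4 * (a^3 + b^3) - (a + b)^3 = 3 * (a + b) * (a - b)\<^sup>2"
    by (simp add: power2_eq_square power3_eq_cube algebra_simps)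
  also have "\<dots> \<ge> 0" using assms by simp
  finally show ?thesis by simp
qed

lemma log_barrier_measurable [measurable]: "log_barrier \<epsilon> R \<in> borel_measurable borel"
  unfolding log_barrier_def[abs_def] by measurable

text \<open>One step of Ito's formula in discrete time. The condition \<open>\<sigma>\<^sup>2 / 2 - C * x\<^sup>2 \<le> x * g x\<close> says exactly that
  the generator \<open>g * V' + \<sigma>\<^sup>2 / 2 * V''\<close> maps \<open>V = - ln\<close> to a function bounded by \<open>C\<close>: the
  repulsion of the drift compensates the Ito correction of the logarithm. Everything else is
  of order \<open>h * sqrt h\<close> or smaller.\<close>

lemma (in brownian_motion) log_barrier_step:
  fixes \<epsilon> R h G C \<sigma> :: real and g :: "real \<Rightarrow> real"
  assumes \<epsilon>: "0 < \<epsilon>" "\<epsilon> \<le> R" and st: "0 \<le> s" "s < t"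
    and Z: "Z \<in> borel_measurable (F s)" and g[measurable]: "g \<in> borel_measurable borel"
    and G: "\<And>x. x \<in> {\<epsilon>..R} \<Longrightarrow> \<bar>g x\<bar> \<le> G"
    and C: "\<And>x. x \<in> {\<epsilon>..R} \<Longrightarrow> \<sigma>\<^sup>2 / 2 - C * x\<^sup>2 \<le> x * g x" "C \<ge> 0"
  defines "h \<equiv> t - s"
    and "V \<equiv> log_barrier \<epsilon> R"
    and "A \<equiv> 8 * ln ((R + 1) / \<epsilon>) / \<epsilon>^3 + 1 + 1 / \<epsilon>^3"
    and "Z' \<equiv> \<lambda>\<omega>. Z \<omega> + (if Z \<omega> \<in> {\<epsilon>..R} then g (Z \<omega>) * h + \<sigma> * (W t \<omega> - W s \<omega>) else 0)"
  shows "expectation (\<lambda>\<omega>. V (Z' \<omega>)) \<le> expectation (\<lambda>\<omega>. V (Z \<omega>)) + C * h + G\<^sup>2 * h\<^sup>2 / (2 * \<epsilon>\<^sup>2)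
     + 4 * A * (G^3 * h^3 + 2 * \<bar>\<sigma>\<bar>^3 * (h * sqrt h))"
proof -
  define D where "D = (\<lambda>\<omega>. W t \<omega> - W s \<omega>)"
  define K where "K = ln ((R + 1) / \<epsilon>)"
  have h: "h > 0" using st by (simp add: h_def)
  have K0: "K \<ge> 0" using \<epsilon> by (auto simp: K_def field_simps intro!: ln_ge_zero)
  have A: "A \<ge> 0" using \<epsilon> K0 unfolding A_def K_def[symmetric] by simp
  have G0: "G \<ge> 0" using G[of \<epsilon>] \<epsilon> by auto
  have [measurable]: "Z \<in> borel_measurable M" "W t \<in> borel_measurable M" "W s \<in> borel_measurable M"
    using measurable_F[OF st(1) Z] st by auto
  have Vb: "0 \<le> V x" "V x \<le> K" for x
    using log_barrier_bounds[OF \<epsilon>] by (auto simp: V_def K_def)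
  have [measurable]: "V \<in> borel_measurable borel" by (simp add: V_def)
  have Vint: "integrable M (\<lambda>\<omega>. V (X \<omega>))" if [measurable]: "X \<in> borel_measurable M" for X
    by (rule integrable_const_bound[of _ K]) (use Vb in auto)
  \<comment> \<open>Coefficients of the increment and of its square in the Taylor bound, both known at time \<open>s\<close>.\<close>
  define \<alpha> where "\<alpha> = (\<lambda>x. if x \<in> {\<epsilon>..R} then - \<sigma> / x + g x * \<sigma> * h / x\<^sup>2 else 0)"
  define \<beta> where "\<beta> = (\<lambda>x. if x \<in> {\<epsilon>..R} then \<sigma>\<^sup>2 / (2 * x\<^sup>2) else 0)"
  have [measurable]: "\<alpha> \<in> borel_measurable borel" "\<beta> \<in> borel_measurable borel"
    unfolding \<alpha>_def \<beta>_def by measurable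
  have \<beta>b: "\<bar>\<beta> x\<bar> \<le> \<sigma>\<^sup>2 / (2 * \<epsilon>\<^sup>2)" for x
    using \<epsilon> by (auto simp: \<beta>_def intro!: divide_left_mono power_mono)
  have \<alpha>b: "\<bar>\<alpha> x\<bar> \<le> \<bar>\<sigma>\<bar> / \<epsilon> + G * \<bar>\<sigma>\<bar> * h / \<epsilon>\<^sup>2" for x
  proof (cases "x \<in> {\<epsilon>..R}")
    case True
    have "\<bar>- \<sigma> / x\<bar> \<le> \<bar>\<sigma>\<bar> / \<epsilon>" using True \<epsilon> by (auto intro!: divide_left_mono)
    moreover have "\<bar>g x * \<sigma> * h / x\<^sup>2\<bar> \<le> G * \<bar>\<sigma>\<bar> * h / \<epsilon>\<^sup>2"
      unfolding abs_divide abs_mult using True \<epsilon> G[OF True] h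
      by (intro frac_le mult_mono) (auto intro!: power_mono)
    ultimately have "\<bar>- \<sigma> / x + g x * \<sigma> * h / x\<^sup>2\<bar> \<le> \<bar>\<sigma>\<bar> / \<epsilon> + G * \<bar>\<sigma>\<bar> * h / \<epsilon>\<^sup>2"
      by linarith
    then show ?thesis unfolding \<alpha>_def if_P[OF True] .
  next
    case False
    then show ?thesis using G0 h \<epsilon> unfolding \<alpha>_def if_not_P[OF False] by simp
  qed
  have sub: "(\<lambda>\<omega>. \<alpha> (Z \<omega>)) \<in> borel_measurable (F s)" "(\<lambda>\<omega>. \<beta> (Z \<omega>)) \<in> borel_measurable (F s)"
    using Z by measurable
  have int: "integrable M (\<lambda>\<omega>. \<alpha> (Z \<omega>))" "integrable M (\<lambda>\<omega>. \<beta> (Z \<omega>))"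
    by (auto intro!: integrable_const_bound[OF AE_I2] \<alpha>b \<beta>b simp: real_norm_def)
  have D: "W t \<omega> - W s \<omega> = D \<omega>" for \<omega> by (simp add: D_def)
  note ea = expectation_mult_incr(1,2)[OF st sub(1) int(1), unfolded D]
  note eb = expectation_mult_incr(3,4)[OF st sub(2) int(2), unfolded D, folded h_def]
  note m = incr_moments[OF st, unfolded D, folded h_def]
  let ?c = "C * h + G\<^sup>2 * h\<^sup>2 / (2 * \<epsilon>\<^sup>2) + 4 * A * G^3 * h^3"
  let ?B = "\<lambda>\<omega>. V (Z \<omega>) + \<alpha> (Z \<omega>) * D \<omega> + \<beta> (Z \<omega>) * (D \<omega>)\<^sup>2 - h * \<beta> (Z \<omega>)
     + 4 * A * \<bar>\<sigma>\<bar>^3 * \<bar>D \<omega>\<bar>^3 + ?c"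
  \<comment> \<open>The drift term has been traded for \<open>C * h - h * \<beta>\<close>, and \<open>h * \<beta>\<close> cancels in the mean against
    \<open>\<beta> * D\<^sup>2\<close>, since the increment has variance \<open>h\<close>.\<close>
  have bound: "V (Z' \<omega>) \<le> ?B \<omega>" for \<omega>
  proof (cases "Z \<omega> \<in> {\<epsilon>..R}")
    case False
    then show ?thesis using A C(2) G0 h by (auto simp: Z'_def \<alpha>_def \<beta>_def)
  next
    case True
    define z d where "z = Z \<omega>" and "d = g z * h + \<sigma> * D \<omega>"
    have z: "\<epsilon> \<le> z" "z \<le> R" "z > 0" "z \<in> {\<epsilon>..R}" using True \<epsilon> by (auto simp: z_def)
    have "V (Z' \<omega>) = V (z + d)" using True by (simp add: Z'_def z_def d_def D_def)
    also have "\<dots> \<le> V z - d / z + d\<^sup>2 / (2 * z\<^sup>2) + A * \<bar>d\<bar>^3"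
      unfolding V_def A_def by (rule log_barrier_taylor) (use \<epsilon> z in auto)
    also have "\<dots> = V z + \<alpha> z * D \<omega> + \<beta> z * (D \<omega>)\<^sup>2 - g z / z * h + (g z)\<^sup>2 * h\<^sup>2 / (2 * z\<^sup>2) + A * \<bar>d\<bar>^3"
      using z by (simp add: \<alpha>_def \<beta>_def d_def power2_eq_square field_simps)
    finally have "V (Z' \<omega>) \<le> \<dots>" .
    moreover have "- (g z / z * h) \<le> C * h - h * \<beta> z"
    proof -
      have "(\<sigma>\<^sup>2 / 2 - C * z\<^sup>2) / z\<^sup>2 \<le> (z * g z) / z\<^sup>2" using C(1)[OF z(4)] by (rule divide_right_mono) simp
      then have "\<beta> z - C \<le> g z / z" using z by (simp add: \<beta>_def power2_eq_square field_simps)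
      then have "(\<beta> z - C) * h \<le> g z / z * h" using h by (intro mult_right_mono) auto
      then show ?thesis by (simp add: algebra_simps)
    qed
    moreover have "(g z)\<^sup>2 * h\<^sup>2 / (2 * z\<^sup>2) \<le> G\<^sup>2 * h\<^sup>2 / (2 * \<epsilon>\<^sup>2)"
      using z \<epsilon> power_mono[OF G[OF z(4)], of 2] by (intro frac_le mult_mono) (auto intro!: power_mono)
    moreover have "A * \<bar>d\<bar>^3 \<le> A * (4 * (G^3 * h^3 + \<bar>\<sigma>\<bar>^3 * \<bar>D \<omega>\<bar>^3))"
    proof (rule mult_left_mono[OF _ A])
      have "\<bar>d\<bar> \<le> \<bar>g z\<bar> * h + \<bar>\<sigma>\<bar> * \<bar>D \<omega>\<bar>"
        using h unfolding d_def by (metis abs_mult abs_of_pos abs_triangle_ineq)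
      also have "\<dots> \<le> G * h + \<bar>\<sigma>\<bar> * \<bar>D \<omega>\<bar>" using G[OF z(4)] h by (intro add_mono mult_right_mono) auto
      finally have "\<bar>d\<bar>^3 \<le> (G * h + \<bar>\<sigma>\<bar> * \<bar>D \<omega>\<bar>)^3" by (rule power_mono) simp
      also have "\<dots> \<le> 4 * ((G * h)^3 + (\<bar>\<sigma>\<bar> * \<bar>D \<omega>\<bar>)^3)" using G0 h by (intro cube_sum_le) auto
      finally show "\<bar>d\<bar>^3 \<le> 4 * (G^3 * h^3 + \<bar>\<sigma>\<bar>^3 * \<bar>D \<omega>\<bar>^3)" by (simp add: power_mult_distrib)
    qed
    ultimately have "V (Z' \<omega>) \<le> V z + \<alpha> z * D \<omega> + \<beta> z * (D \<omega>)\<^sup>2 + (C * h - h * \<beta> z)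
        + G\<^sup>2 * h\<^sup>2 / (2 * \<epsilon>\<^sup>2) + A * (4 * (G^3 * h^3 + \<bar>\<sigma>\<bar>^3 * \<bar>D \<omega>\<bar>^3))"
      by linarith
    then show ?thesis by (simp add: z_def algebra_simps)
  qed
  have Bint: "integrable M ?B" using ea eb m(2)[of 3] int Vint by auto
  have "expectation (\<lambda>\<omega>. V (Z' \<omega>)) \<le> expectation ?B"
  proof (rule integral_mono[OF _ Bint bound])
    show "integrable M (\<lambda>\<omega>. V (Z' \<omega>))" unfolding Z'_def by (rule Vint) measurable
  qed
  also have "expectation ?B = expectation (\<lambda>\<omega>. V (Z \<omega>)) + 4 * A * \<bar>\<sigma>\<bar>^3 * expectation (\<lambda>\<omega>. \<bar>D \<omega>\<bar>^3) + ?c"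
    using ea eb m(2)[of 3] int Vint[of Z] by (simp add: prob_space)
  also have "4 * A * \<bar>\<sigma>\<bar>^3 * expectation (\<lambda>\<omega>. \<bar>D \<omega>\<bar>^3) \<le> 4 * A * \<bar>\<sigma>\<bar>^3 * (2 * (h * sqrt h))"
    using m(5) A by (intro mult_left_mono) auto
  finally show ?thesis by (simp add: algebra_simps)
qed

lemma (in brownian_motion) euler_adapted:
  assumes [measurable]: "g \<in> borel_measurable borel" "S \<in> sets borel" and h: "h \<ge> 0"
  shows "(\<lambda>\<omega>. euler g S \<sigma> y0 h (\<lambda>t. W t \<omega>) k) \<in> borel_measurable (F (real k * h))"
proof (induction k)
  case 0 then show ?case by simp
next
  case (Suc k)
  have le: "0 \<le> real k * h" "real k * h \<le> real (Suc k) * h" using h by (auto intro: mult_right_mono)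
  have [measurable]: "(\<lambda>\<omega>. euler g S \<sigma> y0 h (\<lambda>t. W t \<omega>) k) \<in> borel_measurable (F (real (Suc k) * h))"
    using Suc le by (rule measurable_F_mono)
  have [measurable]: "W (real k * h) \<in> borel_measurable (F (real (Suc k) * h))"
    using adapted_W[OF le(1)] le by (rule measurable_F_mono)
  have [measurable]: "W (real (Suc k) * h) \<in> borel_measurable (F (real (Suc k) * h))"
    using le by (intro adapted_W) auto
  show ?case unfolding euler.simps by measurable
qed

text \<open>Summing the one-step estimate bounds the mean of the barrier at time \<open>T\<close>, while the barrier has its
  maximal value on the exit event. The point is that the right-hand side does not
  involve \<open>\<epsilon>\<close>, whereas the factor \<open>ln ((R + 1) / \<epsilon>)\<close> on the left tends to infinity as \<open>\<epsilon>\<close> decreases.\<close>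

lemma (in brownian_motion) euler_low_exit_prob:
  fixes \<epsilon> R T G C \<sigma> y0 :: real and g :: "real \<Rightarrow> real"
  assumes \<epsilon>: "0 < \<epsilon>" "\<epsilon> \<le> R" and y0: "\<epsilon> \<le> y0" "y0 \<le> R" and T: "T > 0"
    and g: "g \<in> borel_measurable borel"
    and G: "\<And>x. x \<in> {\<epsilon>..R} \<Longrightarrow> \<bar>g x\<bar> \<le> G"
    and C: "\<And>x. x \<in> {\<epsilon>..R} \<Longrightarrow> \<sigma>\<^sup>2 / 2 - C * x\<^sup>2 \<le> x * g x" "C \<ge> 0"
  defines "E \<equiv> {\<omega> \<in> space M. \<forall>\<^sub>F n in sequentially.
      euler g {\<epsilon>..R} \<sigma> y0 (T / real (Suc n)) (\<lambda>t. W t \<omega>) (Suc n) < \<epsilon>}"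
  shows "E \<in> events" "prob E * ln ((R + 1) / \<epsilon>) \<le> ln ((R + 1) / y0) + C * T"
proof -
  define z where "z = (\<lambda>n k \<omega>. euler g {\<epsilon>..R} \<sigma> y0 (T / real (Suc n)) (\<lambda>t. W t \<omega>) k)"
  have zad: "z n k \<in> borel_measurable (F (real k * (T / real (Suc n))))" for n k
    unfolding z_def using T by (intro euler_adapted g) auto
  have [measurable]: "z n k \<in> borel_measurable M" for n k
    by (rule measurable_F[OF _ zad]) (use T in auto)
  have Eeq: "E = {\<omega> \<in> space M. \<exists>N. \<forall>n\<ge>N. z n (Suc n) \<omega> < \<epsilon>}"
    by (simp add: E_def z_def eventually_sequentially)
  show [measurable]: "E \<in> events" unfolding Eeq by measurable
  define K where "K = ln ((R + 1) / \<epsilon>)"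
  define V where "V = log_barrier \<epsilon> R"
  define A where "A = 8 * ln ((R + 1) / \<epsilon>) / \<epsilon>^3 + 1 + 1 / \<epsilon>^3"
  define r where "r = (\<lambda>h. C * h + G\<^sup>2 * h\<^sup>2 / (2 * \<epsilon>\<^sup>2) + 4 * A * (G^3 * h^3 + 2 * \<bar>\<sigma>\<bar>^3 * (h * sqrt h)))"
  have [measurable]: "V \<in> borel_measurable borel" by (simp add: V_def)
  have Vb: "0 \<le> V x" "V x \<le> K" for x
    using log_barrier_bounds[OF \<epsilon>] by (auto simp: V_def K_def)
  have Vint: "integrable M (\<lambda>\<omega>. V (X \<omega>))" if [measurable]: "X \<in> borel_measurable M" for X
    by (rule integrable_const_bound[of _ K]) (use Vb in auto)
  have EV: "expectation (\<lambda>\<omega>. V (z n k \<omega>)) \<le> V y0 + real k * r (T / real (Suc n))" for n k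
  proof (induction k)
    case 0 then show ?case by (simp add: z_def prob_space)
  next
    case (Suc k)
    define h where "h = T / real (Suc n)"
    have h: "h > 0" using T by (simp add: h_def)
    have d: "real (Suc k) * h - real k * h = h" by (simp add: algebra_simps)
    have "expectation (\<lambda>\<omega>. V (z n (Suc k) \<omega>)) \<le> expectation (\<lambda>\<omega>. V (z n k \<omega>)) + r h"
      using log_barrier_step[OF \<epsilon> _ _ zad[of n k, folded h_def] g G C, of "real (Suc k) * h"] h
      unfolding d V_def[symmetric] A_def[symmetric] z_def euler.simps h_def[symmetric]
      by (simp add: r_def algebra_simps)
    then show ?case using Suc unfolding h_def[symmetric] by (simp add: algebra_simps)
  qed
  have Vy0: "V y0 = ln ((R + 1) / y0)" using \<epsilon> y0 by (simp add: V_def log_barrier_def)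
  have low: "prob {\<omega> \<in> space M. z n (Suc n) \<omega> < \<epsilon>} * K \<le> V y0 + real (Suc n) * r (T / real (Suc n))" for n
  proof -
    have "prob {\<omega> \<in> space M. z n (Suc n) \<omega> < \<epsilon>} * K
        = expectation (\<lambda>\<omega>. indicator {\<omega> \<in> space M. z n (Suc n) \<omega> < \<epsilon>} \<omega> * K)"
      by simp
    also have "\<dots> \<le> expectation (\<lambda>\<omega>. V (z n (Suc n) \<omega>))"
    proof (rule integral_mono)
      fix \<omega> assume "\<omega> \<in> space M"
      show "indicator {\<omega> \<in> space M. z n (Suc n) \<omega> < \<epsilon>} \<omega> * K \<le> V (z n (Suc n) \<omega>)"
        using Vb(1) \<epsilon> by (auto simp: indicator_def V_def log_barrier_def K_def max_def min_def)
    qed (auto intro!: Vint integrable_mult_left integrable_real_indicator simp: emeasure_eq_measure)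
    finally show ?thesis using EV[of n "Suc n"] by linarith
  qed
  have hlim: "(\<lambda>n. T / real (Suc n)) \<longlonglongrightarrow> 0"
    using LIMSEQ_Suc[OF lim_const_over_n[of T]] by simp
  have lim: "(\<lambda>n. V y0 + real (Suc n) * r (T / real (Suc n))) \<longlonglongrightarrow> V y0 + C * T"
  proof -
    define q where "q = (\<lambda>h. C + G\<^sup>2 * h / (2 * \<epsilon>\<^sup>2) + 4 * A * (G^3 * h\<^sup>2 + 2 * \<bar>\<sigma>\<bar>^3 * sqrt h))"
    have "r h = h * q h" for h by (simp add: r_def q_def power2_eq_square power3_eq_cube algebra_simps)
    then have "real (Suc n) * r (T / real (Suc n)) = T * q (T / real (Suc n))" for n by simp
    moreover have "(\<lambda>n. V y0 + T * q (T / real (Suc n))) \<longlonglongrightarrow> V y0 + T * q 0"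
      unfolding q_def using \<epsilon>(1) by (intro tendsto_intros hlim) auto
    ultimately show ?thesis by (simp add: q_def mult.commute)
  qed
  \<comment> \<open>The limit inferior of the exit events is an increasing union, so its probability inherits the
    bound that holds for each mesh size.\<close>
  define B where "B = (\<lambda>N. {\<omega> \<in> space M. \<forall>n\<ge>N. z n (Suc n) \<omega> < \<epsilon>})"
  have [measurable]: "B N \<in> events" for N unfolding B_def by measurable
  have K0: "K \<ge> 0" using Vb[of 0] by linarith
  have "prob (B N) * K \<le> V y0 + C * T" for N
  proof (rule LIMSEQ_le_const[OF lim], intro exI[of _ N] allI impI)
    fix n assume "N \<le> n"
    then have "B N \<subseteq> {\<omega> \<in> space M. z n (Suc n) \<omega> < \<epsilon>}" by (auto simp: B_def)
    then have "prob (B N) \<le> prob {\<omega> \<in> space M. z n (Suc n) \<omega> < \<epsilon>}" by (intro finite_measure_mono) auto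
    then show "prob (B N) * K \<le> V y0 + real (Suc n) * r (T / real (Suc n))"
      using low[of n] K0 mult_right_mono by (meson order.trans)
  qed
  moreover have "(\<lambda>N. prob (B N) * K) \<longlonglongrightarrow> prob (\<Union>N. B N) * K"
    by (intro tendsto_intros finite_Lim_measure_incseq) (auto simp: incseq_def B_def)
  ultimately have "prob (\<Union>N. B N) * K \<le> V y0 + C * T" by (intro LIMSEQ_le_const2) auto
  moreover have "(\<Union>N. B N) = E" by (auto simp: B_def Eeq)
  ultimately show "prob E * ln ((R + 1) / \<epsilon>) \<le> ln ((R + 1) / y0) + C * T" by (simp add: K_def Vy0)
qed

section \<open>Ito integrals of constants\<close>

lemma simple_process_times:
  assumes "simple_process M F T n ts \<xi>"
  shows "i \<le> j \<Longrightarrow> j \<le> n \<Longrightarrow> ts i \<le> ts j" "i \<le> n \<Longrightarrow> ts i \<in> {0..T}"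
proof -
  have *: "ts i \<le> ts j" if "i \<le> j" "j \<le> n" for i j
    using that
  proof (induction j rule: dec_induct)
    case (step j)
    then have "ts i \<le> ts j" "ts j < ts (Suc j)" using assms by (auto simp: simple_process_def)
    then show ?case by simp
  qed simp
  show "i \<le> j \<Longrightarrow> j \<le> n \<Longrightarrow> ts i \<le> ts j" by (rule *)
  show "i \<le> n \<Longrightarrow> ts i \<in> {0..T}"
    using *[of 0 i] *[of i n] assms by (auto simp: simple_process_def)
qed

text \<open>The increments are centred and independent of the past, so the mixed terms vanish. This is the
  Ito isometry in the form that an induction over the cells delivers.\<close>

lemma (in brownian_motion) simple_integral_second_moment:
  assumes sp: "simple_process M F T n ts \<xi>" and "k \<le> n"
    and \<eta>: "\<And>i. i < n \<Longrightarrow> \<eta> i \<in> borel_measurable (F (ts i))"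
    and B: "\<And>i \<omega>. i < n \<Longrightarrow> \<omega> \<in> space M \<Longrightarrow> \<bar>\<eta> i \<omega>\<bar> \<le> B"
  defines "S \<equiv> \<lambda>\<omega>. \<Sum>i<k. \<eta> i \<omega> * (W (ts (Suc i)) \<omega> - W (ts i) \<omega>)"
  shows "integrable M (\<lambda>\<omega>. (S \<omega>)\<^sup>2)"
    "expectation (\<lambda>\<omega>. (S \<omega>)\<^sup>2) = (\<Sum>i<k. (ts (Suc i) - ts i) * expectation (\<lambda>\<omega>. (\<eta> i \<omega>)\<^sup>2))"
proof -
  define X where "X = (\<lambda>k \<omega>. \<Sum>i<k. \<eta> i \<omega> * (W (ts (Suc i)) \<omega> - W (ts i) \<omega>))"
  have less: "ts i < ts (Suc i)" "0 \<le> ts i" if "i < n" for i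
    using sp that simple_process_times(2)[OF sp, of i] by (auto simp: simple_process_def)
  have "X k \<in> borel_measurable (F (ts k)) \<and> integrable M (\<lambda>\<omega>. (X k \<omega>)\<^sup>2) \<and>
    expectation (\<lambda>\<omega>. (X k \<omega>)\<^sup>2) = (\<Sum>i<k. (ts (Suc i) - ts i) * expectation (\<lambda>\<omega>. (\<eta> i \<omega>)\<^sup>2))"
    using \<open>k \<le> n\<close>
  proof (induction k)
    case 0 then show ?case by (simp add: X_def)
  next
    case (Suc k)
    then have kn: "k < n" by simp
    note l = less[OF kn]
    define D where "D = (\<lambda>\<omega>. W (ts (Suc k)) \<omega> - W (ts k) \<omega>)"
    have D: "W (ts (Suc k)) \<omega> - W (ts k) \<omega> = D \<omega>" for \<omega> by (simp add: D_def)
    have XS: "X (Suc k) \<omega> = X k \<omega> + \<eta> k \<omega> * D \<omega>" for \<omega> by (simp add: X_def D_def)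
    have IH: "X k \<in> borel_measurable (F (ts k))" "integrable M (\<lambda>\<omega>. (X k \<omega>)\<^sup>2)"
      "expectation (\<lambda>\<omega>. (X k \<omega>)\<^sup>2) = (\<Sum>i<k. (ts (Suc i) - ts i) * expectation (\<lambda>\<omega>. (\<eta> i \<omega>)\<^sup>2))"
      using Suc by auto
    have [measurable]: "X k \<in> borel_measurable M" "\<eta> k \<in> borel_measurable M"
      using measurable_F[OF l(2)] IH(1) \<eta>[OF kn] by auto
    have i1: "integrable M (\<lambda>\<omega>. X k \<omega>)"
      by (rule square_integrable_imp_integrable) (use IH in auto)
    have i2: "integrable M (\<lambda>\<omega>. X k \<omega> * \<eta> k \<omega>)"
    proof (rule Bochner_Integration.integrable_bound)
      show "integrable M (\<lambda>\<omega>. \<bar>X k \<omega>\<bar> * B)" using i1 by auto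
      show "AE \<omega> in M. norm (X k \<omega> * \<eta> k \<omega>) \<le> norm (\<bar>X k \<omega>\<bar> * B)"
      proof (rule AE_I2)
        fix \<omega> assume "\<omega> \<in> space M"
        then have "\<bar>\<eta> k \<omega>\<bar> \<le> \<bar>B\<bar>" using B[OF kn] by fastforce
        then show "norm (X k \<omega> * \<eta> k \<omega>) \<le> norm (\<bar>X k \<omega>\<bar> * B)"
          by (simp add: abs_mult mult_left_mono)
      qed
    qed measurable
    have i3: "integrable M (\<lambda>\<omega>. (\<eta> k \<omega>)\<^sup>2)"
    proof (rule integrable_const_bound)
      show "AE \<omega> in M. norm ((\<eta> k \<omega>)\<^sup>2) \<le> B\<^sup>2"
        using power_mono[OF B[OF kn] abs_ge_zero, of _ 2] by (intro AE_I2) simp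
    qed measurable
    have ms: "(\<lambda>\<omega>. X k \<omega> * \<eta> k \<omega>) \<in> borel_measurable (F (ts k))"
      "(\<lambda>\<omega>. (\<eta> k \<omega>)\<^sup>2) \<in> borel_measurable (F (ts k))"
      using IH(1) \<eta>[OF kn] by measurable
    note e1 = expectation_mult_incr(1,2)[OF l(2,1) ms(1) i2, unfolded D]
    note e2 = expectation_mult_incr(3,4)[OF l(2,1) ms(2) i3, unfolded D]
    have sq: "(X (Suc k) \<omega>)\<^sup>2 = (X k \<omega>)\<^sup>2 + 2 * (X k \<omega> * \<eta> k \<omega> * D \<omega>) + (\<eta> k \<omega>)\<^sup>2 * (D \<omega>)\<^sup>2" for \<omega>
      by (simp add: XS power2_eq_square algebra_simps)
    have "X (Suc k) \<in> borel_measurable (F (ts (Suc k)))"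
    proof -
      have [measurable]: "X k \<in> borel_measurable (F (ts (Suc k)))" "\<eta> k \<in> borel_measurable (F (ts (Suc k)))"
        "W (ts k) \<in> borel_measurable (F (ts (Suc k)))" "W (ts (Suc k)) \<in> borel_measurable (F (ts (Suc k)))"
        by (rule measurable_F_mono[of _ "ts k"], use l IH(1) \<eta>[OF kn] adapted_W in simp_all)+
      show ?thesis unfolding XS[abs_def] D_def by measurable
    qed
    moreover have "integrable M (\<lambda>\<omega>. (X (Suc k) \<omega>)\<^sup>2)"
      unfolding sq using IH(2) e1 e2 by auto
    moreover have "expectation (\<lambda>\<omega>. (X (Suc k) \<omega>)\<^sup>2) =
        expectation (\<lambda>\<omega>. (X k \<omega>)\<^sup>2) + (ts (Suc k) - ts k) * expectation (\<lambda>\<omega>. (\<eta> k \<omega>)\<^sup>2)"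
      unfolding sq using IH(2) e1 e2 by simp
    ultimately show ?case using IH(3) by simp
  qed
  then show "integrable M (\<lambda>\<omega>. (S \<omega>)\<^sup>2)"
    "expectation (\<lambda>\<omega>. (S \<omega>)\<^sup>2) = (\<Sum>i<k. (ts (Suc i) - ts i) * expectation (\<lambda>\<omega>. (\<eta> i \<omega>)\<^sup>2))"
    by (simp_all add: S_def X_def)
qed

text \<open>A constant is itself a simple process on the same partition, so the distance of a simple integral to
  \<open>\<sigma> * (W T - W 0)\<close> is again a simple integral, with coefficients \<open>\<sigma> - \<xi>\<close>.
  The inequality suffices, and spares the discussion of the time \<open>0\<close>, which belongs to no cell.\<close>

lemma (in brownian_motion) simple_integral_isometry:
  assumes sp: "simple_process M F T n ts \<xi>"
  shows "(\<integral>\<^sup>+\<omega>. ennreal ((\<sigma> * (W T \<omega> - W 0 \<omega>) - simple_integral W n ts \<xi> \<omega>)\<^sup>2) \<partial>M)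
    \<le> (\<integral>\<^sup>+\<omega>. (\<integral>\<^sup>+s\<in>{0..T}. ennreal ((\<sigma> - simple_value n ts \<xi> s \<omega>)\<^sup>2) \<partial>lborel) \<partial>M)"
proof -
  define \<eta> where "\<eta> = (\<lambda>i \<omega>. \<sigma> - \<xi> i \<omega>)"
  define S where "S = (\<lambda>\<omega>. \<Sum>i<n. \<eta> i \<omega> * (W (ts (Suc i)) \<omega> - W (ts i) \<omega>))"
  have ends: "ts 0 = 0" "ts n = T" and less: "\<And>i. i < n \<Longrightarrow> ts i < ts (Suc i)"
    using sp by (auto simp: simple_process_def)
  obtain B where B: "\<And>i \<omega>. i < n \<Longrightarrow> \<omega> \<in> space M \<Longrightarrow> \<bar>\<xi> i \<omega>\<bar> \<le> B"
    using sp unfolding simple_process_def by blast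
  have \<eta>m: "\<eta> i \<in> borel_measurable (F (ts i))" if "i < n" for i
  proof -
    have "\<xi> i \<in> borel_measurable (F (ts i))" using sp that by (simp add: simple_process_def)
    then show ?thesis unfolding \<eta>_def by measurable
  qed
  have \<eta>b: "\<bar>\<eta> i \<omega>\<bar> \<le> \<bar>\<sigma>\<bar> + B" if "i < n" "\<omega> \<in> space M" for i \<omega>
    using B[OF that] unfolding \<eta>_def by linarith
  have \<eta>M[measurable]: "\<eta> i \<in> borel_measurable M" if "i < n" for i
    using measurable_F[OF _ \<eta>m] simple_process_times(2)[OF sp, of i] that by auto
  have i3: "integrable M (\<lambda>\<omega>. (\<eta> i \<omega>)\<^sup>2)" if "i < n" for i
  proof (rule integrable_const_bound)
    show "AE \<omega> in M. norm ((\<eta> i \<omega>)\<^sup>2) \<le> (\<bar>\<sigma>\<bar> + B)\<^sup>2"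
      using power_mono[OF \<eta>b[OF that] abs_ge_zero, of _ 2] by (intro AE_I2) simp
    show "(\<lambda>\<omega>. (\<eta> i \<omega>)\<^sup>2) \<in> borel_measurable M" using \<eta>M[OF that] by measurable
  qed
  have tel: "(\<Sum>i<n. W (ts (Suc i)) \<omega> - W (ts i) \<omega>) = W T \<omega> - W 0 \<omega>" for \<omega>
    using sum_lessThan_telescope[of "\<lambda>i. W (ts i) \<omega>" n] ends by simp
  have eq: "\<sigma> * (W T \<omega> - W 0 \<omega>) - simple_integral W n ts \<xi> \<omega> = S \<omega>" for \<omega>
    unfolding tel[symmetric] S_def simple_integral_def \<eta>_def sum_distrib_left sum_subtractf[symmetric]
    by (intro sum.cong) (auto simp: left_diff_distrib)
  have mom: "integrable M (\<lambda>\<omega>. (S \<omega>)\<^sup>2)"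
    "expectation (\<lambda>\<omega>. (S \<omega>)\<^sup>2) = (\<Sum>i<n. (ts (Suc i) - ts i) * expectation (\<lambda>\<omega>. (\<eta> i \<omega>)\<^sup>2))"
    unfolding S_def by (rule simple_integral_second_moment[OF sp order_refl]; fact \<eta>m \<eta>b)+
  have "(\<integral>\<^sup>+\<omega>. ennreal ((S \<omega>)\<^sup>2) \<partial>M) = ennreal (expectation (\<lambda>\<omega>. (S \<omega>)\<^sup>2))"
    by (rule nn_integral_eq_integral[OF mom(1)]) simp
  also have "\<dots> = ennreal (expectation (\<lambda>\<omega>. \<Sum>i<n. (\<eta> i \<omega>)\<^sup>2 * (ts (Suc i) - ts i)))"
    using i3 by (simp add: mom(2) mult.commute)
  also have "\<dots> = (\<integral>\<^sup>+\<omega>. ennreal (\<Sum>i<n. (\<eta> i \<omega>)\<^sup>2 * (ts (Suc i) - ts i)) \<partial>M)"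
  proof (rule nn_integral_eq_integral[symmetric])
    show "integrable M (\<lambda>\<omega>. \<Sum>i<n. (\<eta> i \<omega>)\<^sup>2 * (ts (Suc i) - ts i))" using i3 by auto
    show "AE \<omega> in M. 0 \<le> (\<Sum>i<n. (\<eta> i \<omega>)\<^sup>2 * (ts (Suc i) - ts i))"
      using less by (intro AE_I2 sum_nonneg mult_nonneg_nonneg) (auto simp: less_imp_le)
  qed
  also have "\<dots> \<le> (\<integral>\<^sup>+\<omega>. (\<integral>\<^sup>+s\<in>{0..T}. ennreal ((\<sigma> - simple_value n ts \<xi> s \<omega>)\<^sup>2) \<partial>lborel) \<partial>M)"
  proof (rule nn_integral_mono)
    fix \<omega> assume "\<omega> \<in> space M"
    have "ennreal (\<Sum>i<n. (\<eta> i \<omega>)\<^sup>2 * (ts (Suc i) - ts i))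
        = (\<Sum>i<n. \<integral>\<^sup>+s. ennreal ((\<eta> i \<omega>)\<^sup>2) * indicator {ts i<..ts (Suc i)} s \<partial>lborel)"
      using less by (subst sum_ennreal[symmetric])
        (auto intro!: sum.cong simp: nn_integral_cmult ennreal_mult less_imp_le)
    also have "\<dots> = (\<integral>\<^sup>+s. (\<Sum>i<n. ennreal ((\<eta> i \<omega>)\<^sup>2) * indicator {ts i<..ts (Suc i)} s) \<partial>lborel)"
      by (rule nn_integral_sum[symmetric]) simp
    also have "\<dots> \<le> (\<integral>\<^sup>+s\<in>{0..T}. ennreal ((\<sigma> - simple_value n ts \<xi> s \<omega>)\<^sup>2) \<partial>lborel)"
    proof (rule nn_integral_mono)
      fix s
      show "(\<Sum>i<n. ennreal ((\<eta> i \<omega>)\<^sup>2) * indicator {ts i<..ts (Suc i)} s)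
        \<le> ennreal ((\<sigma> - simple_value n ts \<xi> s \<omega>)\<^sup>2) * indicator {0..T} s"
      proof (cases "\<exists>j<n. s \<in> {ts j<..ts (Suc j)}")
        case False
        then have "(\<Sum>i<n. ennreal ((\<eta> i \<omega>)\<^sup>2) * indicator {ts i<..ts (Suc i)} s) = 0"
          by (intro sum.neutral) (auto simp: indicator_def)
        then show ?thesis by simp
      next
        case True
        then obtain j where j: "j < n" "s \<in> {ts j<..ts (Suc j)}" by blast
        have other: "s \<notin> {ts i<..ts (Suc i)}" if "i < n" "i \<noteq> j" for i
        proof (cases "i < j")
          case True
          then show ?thesis using simple_process_times(1)[OF sp, of "Suc i" j] j by auto
        next
          case False
          then show ?thesis using simple_process_times(1)[OF sp, of "Suc j" i] that j by auto
        qed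
        have "s \<in> {0..T}" using simple_process_times(2)[OF sp, of j] simple_process_times(2)[OF sp, of "Suc j"] j by auto
        moreover have "simple_value n ts \<xi> s \<omega> = (\<Sum>i<n. if i = j then \<xi> j \<omega> else 0)"
          unfolding simple_value_def using other j(2) by (intro sum.cong) auto
        moreover have "(\<Sum>i<n. ennreal ((\<eta> i \<omega>)\<^sup>2) * indicator {ts i<..ts (Suc i)} s)
            = (\<Sum>i<n. if i = j then ennreal ((\<eta> j \<omega>)\<^sup>2) else 0)"
          using other j(2) by (intro sum.cong) auto
        ultimately show ?thesis using j(1) by (simp add: \<eta>_def)
      qed
    qed
    finally show "ennreal (\<Sum>i<n. (\<eta> i \<omega>)\<^sup>2 * (ts (Suc i) - ts i))
      \<le> (\<integral>\<^sup>+s\<in>{0..T}. ennreal ((\<sigma> - simple_value n ts \<xi> s \<omega>)\<^sup>2) \<partial>lborel)" .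
  qed
  finally show ?thesis by (simp add: eq)
qed

text \<open>Uniqueness of solutions quantifies over every process that qualifies as an Ito integral of \<open>\<sigma>\<close>. By the isometry
  the two mean-square limits in the definition force each of them to be \<open>\<sigma> * W\<close>.\<close>

lemma (in brownian_motion) ito_integral_const_unique:
  assumes T: "T \<ge> 0" and J: "is_ito_integral M F W T (\<lambda>_ _. \<sigma>) J"
  shows "AE \<omega> in M. J \<omega> = \<sigma> * W T \<omega>"
proof -
  obtain n ts \<xi> where sp: "\<And>k. simple_process M F T (n k) (ts k) (\<xi> k)"
    and lim: "(\<lambda>k. \<integral>\<^sup>+\<omega>. (\<integral>\<^sup>+s\<in>{0..T}. ennreal ((\<sigma> - simple_value (n k) (ts k) (\<xi> k) s \<omega>)\<^sup>2) \<partial>lborel) \<partial>M) \<longlonglongrightarrow> 0"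
      (is "?a \<longlonglongrightarrow> 0")
    "(\<lambda>k. \<integral>\<^sup>+\<omega>. ennreal ((J \<omega> - simple_integral W (n k) (ts k) (\<xi> k) \<omega>)\<^sup>2) \<partial>M) \<longlonglongrightarrow> 0"
      (is "?b \<longlonglongrightarrow> 0")
    using J unfolding is_ito_integral_def by blast
  have [measurable]: "J \<in> borel_measurable M" using J by (simp add: is_ito_integral_def)
  have [measurable]: "W T \<in> borel_measurable M" "W 0 \<in> borel_measurable M" using T by auto
  have [measurable]: "simple_integral W (n k) (ts k) (\<xi> k) \<in> borel_measurable M" for k
  proof -
    have "\<xi> k i \<in> borel_measurable M" "W (ts k i) \<in> borel_measurable M" "W (ts k (Suc i)) \<in> borel_measurable M"
      if "i < n k" for i
    proof -
      have t: "0 \<le> ts k i" "0 \<le> ts k (Suc i)"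
        using that simple_process_times(2)[OF sp, of i k] simple_process_times(2)[OF sp, of "Suc i" k] by auto
      have "\<xi> k i \<in> borel_measurable (F (ts k i))" using sp[of k] that by (simp add: simple_process_def)
      then show "\<xi> k i \<in> borel_measurable M" using t(1) by (rule measurable_F[rotated])
      show "W (ts k i) \<in> borel_measurable M" "W (ts k (Suc i)) \<in> borel_measurable M"
        using t by (auto intro: measurable_W)
    qed
    then show ?thesis unfolding simple_integral_def[abs_def]
      by (intro borel_measurable_sum borel_measurable_times borel_measurable_diff) auto
  qed
  let ?d = "\<integral>\<^sup>+\<omega>. ennreal ((J \<omega> - \<sigma> * (W T \<omega> - W 0 \<omega>))\<^sup>2) \<partial>M"
  have "?d \<le> 2 * ?b k + 2 * ?a k" for k
  proof -
    let ?S = "simple_integral W (n k) (ts k) (\<xi> k)"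
    have "?d \<le> (\<integral>\<^sup>+\<omega>. 2 * ennreal ((J \<omega> - ?S \<omega>)\<^sup>2) + 2 * ennreal ((\<sigma> * (W T \<omega> - W 0 \<omega>) - ?S \<omega>)\<^sup>2) \<partial>M)"
    proof (rule nn_integral_mono)
      fix \<omega>
      define u v where "u = J \<omega> - ?S \<omega>" and "v = \<sigma> * (W T \<omega> - W 0 \<omega>) - ?S \<omega>"
      have "0 \<le> (u + v)\<^sup>2" by simp
      then have "(u - v)\<^sup>2 \<le> 2 * u\<^sup>2 + 2 * v\<^sup>2" by (simp add: power2_eq_square algebra_simps)
      then have "ennreal ((u - v)\<^sup>2) \<le> ennreal (2 * u\<^sup>2 + 2 * v\<^sup>2)" by (rule ennreal_leI)
      also have "\<dots> = 2 * ennreal (u\<^sup>2) + 2 * ennreal (v\<^sup>2)" by (simp add: ennreal_plus ennreal_mult)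
      finally show "ennreal ((J \<omega> - \<sigma> * (W T \<omega> - W 0 \<omega>))\<^sup>2)
          \<le> 2 * ennreal ((J \<omega> - ?S \<omega>)\<^sup>2) + 2 * ennreal ((\<sigma> * (W T \<omega> - W 0 \<omega>) - ?S \<omega>)\<^sup>2)"
        by (simp add: u_def v_def)
    qed
    also have "\<dots> = 2 * ?b k + 2 * (\<integral>\<^sup>+\<omega>. ennreal ((\<sigma> * (W T \<omega> - W 0 \<omega>) - ?S \<omega>)\<^sup>2) \<partial>M)"
      by (simp add: nn_integral_add nn_integral_cmult)
    also have "\<dots> \<le> 2 * ?b k + 2 * ?a k"
      by (intro add_left_mono mult_left_mono simple_integral_isometry sp) simp
    finally show ?thesis .
  qed
  moreover have "(\<lambda>k. 2 * ?b k + 2 * ?a k) \<longlonglongrightarrow> 2 * 0 + 2 * 0"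
    by (intro tendsto_add ennreal_tendsto_cmult lim) auto
  ultimately have "?d \<le> 2 * 0 + 2 * 0" by (intro LIMSEQ_le_const) blast+
  then have "?d = 0" by simp
  moreover have "(\<lambda>\<omega>. ennreal ((J \<omega> - \<sigma> * (W T \<omega> - W 0 \<omega>))\<^sup>2)) \<in> borel_measurable M" by measurable
  ultimately have "AE \<omega> in M. ennreal ((J \<omega> - \<sigma> * (W T \<omega> - W 0 \<omega>))\<^sup>2) = 0"
    by (simp add: nn_integral_0_iff_AE)
  with start_W show ?thesis
    by eventually_elim (simp add: ennreal_eq_0_iff)
qed

lemma (in brownian_motion) ito_integral_const:
  assumes T: "T \<ge> 0"
  shows "is_ito_integral M F W T (\<lambda>_ _. \<sigma>) (\<lambda>\<omega>. \<sigma> * W T \<omega>)"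
proof -
  \<comment> \<open>Partition points must increase strictly, hence the empty partition for \<open>T = 0\<close>.\<close>
  define n :: nat where "n = (if T = 0 then 0 else 1)"
  define ts where "ts = (\<lambda>i::nat. if i = 0 then 0 else T)"
  define \<xi> :: "nat \<Rightarrow> 'a \<Rightarrow> real" where "\<xi> = (\<lambda>_ _. \<sigma>)"
  have sp: "simple_process M F T n ts \<xi>"
    using T by (auto simp: simple_process_def n_def ts_def \<xi>_def)
  have val: "(\<integral>\<^sup>+s\<in>{0..T}. ennreal ((\<sigma> - simple_value n ts \<xi> s \<omega>)\<^sup>2) \<partial>lborel) = 0" for \<omega>
  proof -
    have "AE s in lborel. ennreal ((\<sigma> - simple_value n ts \<xi> s \<omega>)\<^sup>2) * indicator {0..T} s = 0"
      using AE_lborel_singleton[of 0]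
      by eventually_elim (use T in \<open>auto simp: simple_value_def n_def ts_def \<xi>_def indicator_def\<close>)
    then have "(\<integral>\<^sup>+s\<in>{0..T}. ennreal ((\<sigma> - simple_value n ts \<xi> s \<omega>)\<^sup>2) \<partial>lborel) = (\<integral>\<^sup>+s. 0 \<partial>(lborel :: real measure))"
      by (rule nn_integral_cong_AE)
    then show ?thesis by simp
  qed
  have "AE \<omega> in M. ennreal ((\<sigma> * W T \<omega> - simple_integral W n ts \<xi> \<omega>)\<^sup>2) = 0"
    using start_W
    by eventually_elim (simp add: simple_integral_def n_def ts_def \<xi>_def algebra_simps)
  then have "(\<integral>\<^sup>+\<omega>. ennreal ((\<sigma> * W T \<omega> - simple_integral W n ts \<xi> \<omega>)\<^sup>2) \<partial>M) = (\<integral>\<^sup>+\<omega>. 0 \<partial>M)"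
    by (rule nn_integral_cong_AE)
  then have "(\<lambda>k::nat. \<integral>\<^sup>+\<omega>. ennreal ((\<sigma> * W T \<omega> - simple_integral W n ts \<xi> \<omega>)\<^sup>2) \<partial>M) \<longlonglongrightarrow> 0"
    by simp
  then show ?thesis unfolding is_ito_integral_def using T sp val
    by (intro conjI exI[of _ "\<lambda>_. n"] exI[of _ "\<lambda>_. ts"] exI[of _ "\<lambda>_. \<xi>"]) auto
qed

lemma continuous_eq_on_rationals:
  fixes f g :: "real \<Rightarrow> real"
  assumes f: "continuous_on {0..} f" and g: "continuous_on {0..} g"
    and eq: "\<And>a b :: nat. f (real a / real (Suc b)) = g (real a / real (Suc b))" and t: "t \<ge> 0"
  shows "f t = g t"
proof -
  define q where "q = (\<lambda>b. real (nat \<lceil>t * real (Suc b)\<rceil>) / real (Suc b))"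
  have bound: "t \<le> q b" "q b \<le> t + 1 / real (Suc b)" for b
  proof -
    have "real (nat \<lceil>t * real (Suc b)\<rceil>) = of_int \<lceil>t * real (Suc b)\<rceil>" using t by simp
    then have *: "t * real (Suc b) \<le> real (nat \<lceil>t * real (Suc b)\<rceil>)"
      "real (nat \<lceil>t * real (Suc b)\<rceil>) \<le> t * real (Suc b) + 1"
      by linarith+
    show "t \<le> q b" unfolding q_def using *(1) by (subst pos_le_divide_eq) auto
    have "q b \<le> (t * real (Suc b) + 1) / real (Suc b)"
      unfolding q_def using *(2) by (rule divide_right_mono) simp
    also have "\<dots> = t + 1 / real (Suc b)" by (simp add: add_divide_distrib)
    finally show "q b \<le> t + 1 / real (Suc b)" .
  qed
  have up: "(\<lambda>b. t + 1 / real (Suc b)) \<longlonglongrightarrow> t"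
    using LIMSEQ_inverse_real_of_nat_add[of t] unfolding inverse_eq_divide .
  have q: "q \<longlonglongrightarrow> t"
    by (rule tendsto_sandwich[OF _ _ tendsto_const up]) (simp_all add: bound del: of_nat_Suc)
  have q0: "0 \<le> q b" for b using t bound(1)[of b] by linarith
  have "(\<lambda>b. f (q b)) \<longlonglongrightarrow> f t"
    by (rule continuous_on_tendsto_compose[OF f q]) (use t q0 in auto)
  moreover have "(\<lambda>b. g (q b)) \<longlonglongrightarrow> g t"
    by (rule continuous_on_tendsto_compose[OF g q]) (use t q0 in auto)
  moreover have "f (q b) = g (q b)" for b unfolding q_def by (rule eq)
  ultimately show ?thesis using LIMSEQ_unique by auto
qed

lemma (in brownian_motion) ito_integral_process_const:
  "is_ito_integral_process M F W (\<lambda>_ _. \<sigma>) (\<lambda>t \<omega>. \<sigma> * W t \<omega>)"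
  unfolding is_ito_integral_process_def
proof (intro conjI allI impI ito_integral_const)
  show "AE \<omega> in M. continuous_on {0..} (\<lambda>t. \<sigma> * W t \<omega>)"
    using cont_W by eventually_elim (intro continuous_intros)
qed

lemma (in brownian_motion) ito_integral_process_const_unique:
  assumes I: "is_ito_integral_process M F W (\<lambda>_ _. \<sigma>) I"
  shows "AE \<omega> in M. \<forall>t\<ge>0. I t \<omega> = \<sigma> * W t \<omega>"
proof -
  have "AE \<omega> in M. \<forall>a b :: nat. I (real a / real (Suc b)) \<omega> = \<sigma> * W (real a / real (Suc b)) \<omega>"
    unfolding AE_all_countable
  proof (intro allI ito_integral_const_unique)
    fix a b :: nat
    show t: "0 \<le> real a / real (Suc b)" by simp
    show "is_ito_integral M F W (real a / real (Suc b)) (\<lambda>_ _. \<sigma>) (I (real a / real (Suc b)))"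
      using I t unfolding is_ito_integral_process_def by blast
  qed
  moreover have "AE \<omega> in M. continuous_on {0..} (\<lambda>t. I t \<omega>)"
    using I by (simp add: is_ito_integral_process_def)
  ultimately show ?thesis using cont_W
  proof eventually_elim
    case (elim \<omega>)
    show ?case
    proof (intro allI impI)
      fix t :: real assume "0 \<le> t"
      show "I t \<omega> = \<sigma> * W t \<omega>"
      proof (rule continuous_eq_on_rationals[of "\<lambda>t. I t \<omega>" "\<lambda>t. \<sigma> * W t \<omega>"])
        show "continuous_on {0..} (\<lambda>t. I t \<omega>)" by (rule elim(2))
        show "continuous_on {0..} (\<lambda>t. \<sigma> * W t \<omega>)" using elim(3) by (rule continuous_on_mult_left)
        show "I (real a / real (Suc b)) \<omega> = \<sigma> * W (real a / real (Suc b)) \<omega>" for a b :: nat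
          using elim(1) by blast
      qed fact
    qed
  qed
qed

section \<open>Truncated drifts\<close>

text \<open>Clamping the argument to \<open>{1 / (m + 1)..m + 1}\<close> makes a drift on the open half line globally
  Lipschitz and bounded, and leaves it unchanged on that interval.\<close>

definition truncate_drift :: "(real \<Rightarrow> real) \<Rightarrow> nat \<Rightarrow> real \<Rightarrow> real" where
  "truncate_drift f m x = f (max (1 / real (Suc m)) (min x (real (Suc m))))"

lemma truncate_drift_eq: "x \<in> {1 / real (Suc m)..real (Suc m)} \<Longrightarrow> truncate_drift f m x = f x"
  by (simp add: truncate_drift_def max_def min_def)

lemma truncate_drift_lipschitz:
  assumes "L-lipschitz_on {1 / real (Suc m)..real (Suc m)} f"
  shows "L-lipschitz_on UNIV (truncate_drift f m)"
proof (rule lipschitz_onI)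
  show "0 \<le> L" using lipschitz_on_nonneg[OF assms] .
  fix x y :: real
  define c where "c = (\<lambda>x. max (1 / real (Suc m)) (min x (real (Suc m))))"
  have c: "c x \<in> {1 / real (Suc m)..real (Suc m)}" for x by (auto simp: c_def field_simps)
  have "dist (f (c x)) (f (c y)) \<le> L * dist (c x) (c y)" by (rule lipschitz_onD[OF assms c c])
  also have "\<dots> \<le> L * dist x y"
    using lipschitz_on_nonneg[OF assms] by (intro mult_left_mono) (auto simp: c_def dist_real_def)
  finally show "dist (truncate_drift f m x) (truncate_drift f m y) \<le> L * dist x y"
    by (simp add: truncate_drift_def c_def)
qed

lemma truncate_drift_bounded:
  assumes "continuous_on {1 / real (Suc m)..real (Suc m)} f"
  shows "\<exists>G. \<forall>x. \<bar>truncate_drift f m x\<bar> \<le> G"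
proof -
  have "bounded (f ` {1 / real (Suc m)..real (Suc m)})"
    by (intro compact_imp_bounded compact_continuous_image assms) simp
  then obtain G where "\<And>x. x \<in> {1 / real (Suc m)..real (Suc m)} \<Longrightarrow> \<bar>f x\<bar> \<le> G"
    unfolding bounded_iff by fastforce
  moreover have "max (1 / real (Suc m)) (min x (real (Suc m))) \<in> {1 / real (Suc m)..real (Suc m)}" for x
    by (auto simp: field_simps)
  ultimately show ?thesis unfolding truncate_drift_def by blast
qed

text \<open>Above the level \<open>1\<close> the drift pushes up at rate at most \<open>C\<close>. After the last visit
  below that level (or from the start, if there is none) the path can therefore only gain \<open>C * T\<close>
  from the drift and twice the maximal size of the noise. The bound does not depend on \<open>g\<close> except
  through \<open>C\<close>, which makes it uniform over truncations of a drift.\<close>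

lemma no_upward_explosion:
  assumes y: "solves_upto T g \<sigma> y0 w y" and g: "continuous_on {0..T} (\<lambda>s. g (y s))"
    and C: "\<And>x. x \<ge> 1 \<Longrightarrow> g x \<le> C" "C \<ge> 0"
    and B: "\<And>t. t \<in> {0..T} \<Longrightarrow> \<bar>w t\<bar> \<le> B" and t: "t \<in> {0..T}"
  shows "y t \<le> max 1 y0 + C * T + 2 * \<bar>\<sigma>\<bar> * B"
proof -
  have B0: "B \<ge> 0" using B[OF t] by linarith
  have yc: "continuous_on {0..T} y" using y by (simp add: solves_upto_def)
  have yeq: "y t = y0 + integral {0..t} (\<lambda>s. g (y s)) + \<sigma> * w t" if "t \<in> {0..T}" for t
    using y that by (auto simp: solves_upto_def)
  have \<sigma>w: "\<bar>\<sigma> * w t\<bar> \<le> \<bar>\<sigma>\<bar> * B" if "t \<in> {0..T}" for t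
    using B[OF that] by (simp add: abs_mult mult_left_mono)
  have gi: "(\<lambda>s. g (y s)) integrable_on {a..b}" if "0 \<le> a" "b \<le> T" for a b
    using that by (intro integrable_continuous_real continuous_on_subset[OF g]) auto
  have drift: "integral {a..b} (\<lambda>s. g (y s)) \<le> C * T"
    if "0 \<le> a" "a \<le> b" "b \<le> T" "\<And>s. s \<in> {a<..b} \<Longrightarrow> y s \<ge> 1" for a b
  proof -
    have "integral {a..b} (\<lambda>s. g (y s)) = integral {a<..b} (\<lambda>s. g (y s))"
      by (rule integral_subset_negligible[symmetric]) (auto intro: negligible_subset[of "{a}"])
    also have "\<dots> \<le> integral {a<..b} (\<lambda>s. C)"
    proof (rule integral_le)
      show "(\<lambda>s. g (y s)) integrable_on {a<..b}"
        by (rule integrable_spike_set[OF gi[OF that(1,3)]]) (auto intro: negligible_subset[of "{a}"])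
      show "(\<lambda>s. C) integrable_on {a<..b}"
        by (rule integrable_spike_set[OF integrable_const_ivl[of C a b]]) (auto intro: negligible_subset[of "{a}"])
      show "g (y s) \<le> C" if "s \<in> {a<..b}" for s using that \<open>\<And>s. s \<in> {a<..b} \<Longrightarrow> y s \<ge> 1\<close> by (intro C) auto
    qed
    also have "integral {a<..b} (\<lambda>s. C) = integral {a..b} (\<lambda>s. C)"
      by (rule integral_subset_negligible) (auto intro: negligible_subset[of "{a}"])
    also have "\<dots> = (b - a) * C" using that by simp
    also have "\<dots> \<le> T * C" using that C by (intro mult_right_mono) auto
    finally show ?thesis by (simp add: mult.commute)
  qed
  show ?thesis
  proof (cases "\<exists>s\<in>{0..t}. y s \<le> 1")
    case False
    have "integral {0..t} (\<lambda>s. g (y s)) \<le> C * T" using False t by (intro drift) (auto simp: not_le less_imp_le)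
    moreover have "\<bar>\<sigma>\<bar> * B \<ge> 0" using B0 by simp
    ultimately show ?thesis using yeq[OF t] \<sigma>w[OF t] by linarith
  next
    case True
    define A where "A = {s\<in>{0..t}. y s \<le> 1}"
    have "A = {0..t} \<inter> y -` {..1}" by (auto simp: A_def)
    then have "closed A"
      using t by (auto intro!: continuous_closed_preimage continuous_on_subset[OF yc])
    moreover have "bounded A" by (rule bounded_subset[of "{0..t}"]) (auto simp: A_def)
    ultimately have "compact A" by (simp add: compact_eq_bounded_closed)
    moreover have "A \<noteq> {}" using True by (auto simp: A_def)
    ultimately obtain a where a: "a \<in> A" "\<And>s. s \<in> A \<Longrightarrow> s \<le> a"
      using compact_attains_sup[of A] by blast
    have at: "0 \<le> a" "a \<le> t" "y a \<le> 1" using a(1) by (auto simp: A_def)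
    have "y t - y a = integral {a..t} (\<lambda>s. g (y s)) + \<sigma> * w t - \<sigma> * w a"
      using yeq[of a] yeq[of t] at t
        Henstock_Kurzweil_Integration.integral_combine[of 0 a t "\<lambda>s. g (y s)"] gi[of 0 t] by simp
    moreover have "integral {a..t} (\<lambda>s. g (y s)) \<le> C * T"
    proof (rule drift)
      fix s assume "s \<in> {a<..t}"
      then show "y s \<ge> 1" using a(2)[of s] at by (force simp: A_def)
    qed (use at t in auto)
    ultimately show ?thesis using \<sigma>w[OF t] \<sigma>w[of a] at t by simp
  qed
qed

section \<open>Positive solutions for drifts repelled from zero\<close>

lemma positive_continuous_image:
  fixes y :: "real \<Rightarrow> real"
  assumes "continuous_on {0..T} y" "\<And>t. t \<in> {0..T} \<Longrightarrow> 0 < y t"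
  obtains a b where "0 < a" "y ` {0..T} \<subseteq> {a..b}"
proof (cases "0 \<le> T")
  case True
  obtain s where s: "s \<in> {0..T}" "\<And>t. t \<in> {0..T} \<Longrightarrow> y s \<le> y t"
    using continuous_attains_inf[of "{0..T}" y] assms True by auto
  obtain u where u: "u \<in> {0..T}" "\<And>t. t \<in> {0..T} \<Longrightarrow> y t \<le> y u"
    using continuous_attains_sup[of "{0..T}" y] assms True by auto
  have "y ` {0..T} \<subseteq> {y s..y u}" using s(2) u(2) by (simp add: image_subset_iff)
  then show ?thesis by (rule that[OF assms(2)[OF s(1)]])
qed (use that[of 1 1] in auto)

lemma continuous_on_halfline:
  assumes "\<And>T. 0 \<le> T \<Longrightarrow> continuous_on {0..T} (y :: real \<Rightarrow> real)"
  shows "continuous_on {0..} y"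
  unfolding continuous_on_eq_continuous_within
proof
  fix x :: real assume "x \<in> {0..}"
  then have x: "x \<in> {0..x + 1}" "0 \<le> x + 1" by auto
  have "at x within {0..} = at x within {0..x + 1}"
    by (rule at_within_nhd[of x "{..<x + 1}"]) auto
  then show "continuous (at x within {0..}) y"
    using assms[OF x(2)] x(1) by (simp add: continuous_on_eq_continuous_within)
qed

text \<open>The three conditions on the drift are local well-posedness, no push to infinity,
  and repulsion from zero. The last one has the critical constant: for \<open>f x = c / x\<close> it says
  \<open>c \<ge> \<sigma>\<^sup>2 / 2\<close>, the threshold at which a Bessel process (then of dimension at least two) does not hit zero.\<close>

locale positive_drift_sde = brownian_motion M F W
  for M :: "'a measure" and F W +
  fixes f :: "real \<Rightarrow> real" and \<sigma> y0 :: real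
  assumes y0: "0 < y0"
    and lipschitz: "\<And>a b. 0 < a \<Longrightarrow> \<exists>L. L-lipschitz_on {a..b} f"
    and upper: "\<exists>C. \<forall>x\<ge>1. f x \<le> C"
    and repelling: "\<And>R. \<exists>C. \<forall>x. 0 < x \<longrightarrow> x \<le> R \<longrightarrow> \<sigma>\<^sup>2 / 2 - C * x\<^sup>2 \<le> x * f x"
begin

abbreviation band :: "nat \<Rightarrow> real set" where
  "band m \<equiv> {1 / real (Suc m)..real (Suc m)}"

lemma trunc_lipschitz: "\<exists>L. L-lipschitz_on UNIV (truncate_drift f m)"
  using lipschitz[of "1 / real (Suc m)" "real (Suc m)"] truncate_drift_lipschitz by auto

lemma trunc_continuous: "continuous_on UNIV (truncate_drift f m)"
  using trunc_lipschitz lipschitz_on_continuous_on by blast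

lemma trunc_measurable [measurable]: "truncate_drift f m \<in> borel_measurable borel"
  by (rule borel_measurable_continuous_onI[OF trunc_continuous])

lemma trunc_bounded: "\<exists>G. \<forall>x. \<bar>truncate_drift f m x\<bar> \<le> G"
proof (rule truncate_drift_bounded)
  show "continuous_on (band m) f"
    using lipschitz[of "1 / real (Suc m)" "real (Suc m)"] lipschitz_on_continuous_on by auto
qed

lemma band_mono: "m \<le> n \<Longrightarrow> band m \<subseteq> band n"
  by (auto intro: order_trans[of "1 / real (Suc n)" "1 / real (Suc m)"] simp: frac_le)

definition good_path :: "'a \<Rightarrow> bool" where
  "good_path \<omega> \<longleftrightarrow> W 0 \<omega> = 0 \<and> continuous_on {0..} (\<lambda>t. W t \<omega>)"

lemma AE_good_path: "AE \<omega> in M. good_path \<omega>"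
  using start_W cont_W by eventually_elim (simp add: good_path_def)

definition trunc_sol :: "nat \<Rightarrow> 'a \<Rightarrow> real \<Rightarrow> real" where
  "trunc_sol m \<omega> = (SOME y. \<forall>T. solves_upto T (truncate_drift f m) \<sigma> y0 (\<lambda>t. W t \<omega>) y)"

lemma trunc_sol:
  assumes "good_path \<omega>"
  shows "solves_upto T (truncate_drift f m) \<sigma> y0 (\<lambda>t. W t \<omega>) (trunc_sol m \<omega>)"
proof -
  obtain L G where "L-lipschitz_on UNIV (truncate_drift f m)" "\<And>x. \<bar>truncate_drift f m x\<bar> \<le> G"
    using trunc_lipschitz trunc_bounded by blast
  then have "\<exists>y. \<forall>T. solves_upto T (truncate_drift f m) \<sigma> y0 (\<lambda>t. W t \<omega>) y"
    using assms by (intro picard_existence) (auto simp: good_path_def)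
  from someI_ex[OF this] show ?thesis by (simp add: trunc_sol_def)
qed

text \<open>On a bounded time interval a solution of the original equation that stays positive has a compact range, so it is
  already a solution of some truncated equation that never leaves its band. Conversely, such
  truncated solutions agree as long as they are confined, and together they form the global solution.\<close>

definition confined :: "'a \<Rightarrow> bool" where
  "confined \<omega> \<longleftrightarrow> good_path \<omega> \<and> (\<forall>N::nat. \<exists>m. trunc_sol m \<omega> ` {0..real N} \<subseteq> band m)"

lemma solves_f_if_in_band:
  assumes "good_path \<omega>" "trunc_sol m \<omega> ` {0..T} \<subseteq> band m"
  shows "solves_upto T f \<sigma> y0 (\<lambda>t. W t \<omega>) (trunc_sol m \<omega>)"
  using solves_upto_cong_drift[OF trunc_sol[OF assms(1)]] truncate_drift_eq assms(2) by blast

text \<open>A truncated solution confined to its band also solves every less truncated equation, so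
  uniqueness for the latter applies.\<close>

lemma trunc_sol_consistent:
  assumes gp: "good_path \<omega>" and b: "trunc_sol m \<omega> ` {0..T} \<subseteq> band m" and mn: "m \<le> n" and t: "t \<in> {0..T}"
  shows "trunc_sol n \<omega> t = trunc_sol m \<omega> t"
proof -
  have "solves_upto T (truncate_drift f n) \<sigma> y0 (\<lambda>t. W t \<omega>) (trunc_sol m \<omega>)"
    using solves_upto_cong_drift[OF solves_f_if_in_band[OF gp b]] truncate_drift_eq b band_mono[OF mn]
    by (metis image_subset_iff subset_iff)
  moreover obtain L where "L-lipschitz_on UNIV (truncate_drift f n)" using trunc_lipschitz by blast
  ultimately show ?thesis
    using solution_unique[OF _ trunc_sol[OF gp] _ _ _ t] by auto
qed

text \<open>The solution as an iterated limit of Euler schemes. Choosing solutions path by path would say nothing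
  about measurability; a limit of adapted processes is adapted, on all paths alike.\<close>

definition Y :: "real \<Rightarrow> 'a \<Rightarrow> real" where
  "Y t \<omega> = lim (\<lambda>m. lim (\<lambda>n. euler (truncate_drift f m) UNIV \<sigma> y0 (t / real (Suc n)) (\<lambda>t. W t \<omega>) (Suc n)))"

lemma Y_adapted:
  assumes "0 \<le> t"
  shows "Y t \<in> borel_measurable (F t)"
proof -
  have [measurable]: "(\<lambda>\<omega>. euler (truncate_drift f m) UNIV \<sigma> y0 (t / real (Suc n)) (\<lambda>t. W t \<omega>) (Suc n))
      \<in> borel_measurable (F t)" for m n
    using euler_adapted[of "truncate_drift f m" UNIV "t / real (Suc n)" \<sigma> y0 "Suc n"] assms by simp
  show ?thesis unfolding Y_def[abs_def] by measurable
qed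

lemma Y_eq_trunc_sol:
  assumes gp: "good_path \<omega>" and b: "trunc_sol m \<omega> ` {0..T} \<subseteq> band m" and t: "t \<in> {0..T}"
  shows "Y t \<omega> = trunc_sol m \<omega> t"
proof -
  have "lim (\<lambda>n. euler (truncate_drift f k) UNIV \<sigma> y0 (t / real (Suc n)) (\<lambda>t. W t \<omega>) (Suc n)) = trunc_sol k \<omega> t" for k
  proof (rule limI)
    obtain L where "L-lipschitz_on UNIV (truncate_drift f k)" using trunc_lipschitz by blast
    then show "(\<lambda>n. euler (truncate_drift f k) UNIV \<sigma> y0 (t / real (Suc n)) (\<lambda>t. W t \<omega>) (Suc n)) \<longlonglongrightarrow> trunc_sol k \<omega> t"
      using euler_tendsto[OF _ trunc_sol[OF gp]] gp t by (auto simp: good_path_def)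
  qed
  moreover have "(\<lambda>k. trunc_sol k \<omega> t) \<longlonglongrightarrow> trunc_sol m \<omega> t"
    using trunc_sol_consistent[OF gp b _ t] by (intro tendsto_eventually eventually_sequentiallyI[of m])
  ultimately show ?thesis unfolding Y_def by (simp add: limI)
qed

lemma trunc_sol_bounded_above:
  assumes gp: "good_path \<omega>"
  shows "\<exists>R. \<forall>m. \<forall>t\<in>{0..T}. trunc_sol m \<omega> t \<le> R"
proof -
  obtain C where C: "\<And>x. x \<ge> 1 \<Longrightarrow> f x \<le> C" using upper by blast
  have g: "truncate_drift f m x \<le> max C 0" if "x \<ge> 1" for m x
  proof -
    have "1 / real (Suc m) \<le> 1" by simp
    then have "max (1 / real (Suc m)) (min x (real (Suc m))) \<ge> 1" using that by auto
    then show ?thesis unfolding truncate_drift_def by (intro order_trans[OF C]) auto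
  qed
  have "bounded ((\<lambda>t. W t \<omega>) ` {0..T})"
    using gp by (intro compact_imp_bounded compact_continuous_image)
      (auto simp: good_path_def elim: continuous_on_subset)
  then obtain B where B: "\<And>t. t \<in> {0..T} \<Longrightarrow> \<bar>W t \<omega>\<bar> \<le> B"
    unfolding bounded_iff by fastforce
  have "trunc_sol m \<omega> t \<le> max 1 y0 + max C 0 * T + 2 * \<bar>\<sigma>\<bar> * B" if "t \<in> {0..T}" for m t
  proof (rule no_upward_explosion[OF trunc_sol[OF gp] _ _ _ B that])
    show "continuous_on {0..T} (\<lambda>s. truncate_drift f m (trunc_sol m \<omega> s))"
      using trunc_sol[OF gp, of T m] by (intro continuous_on_compose2[OF trunc_continuous]) (auto simp: solves_upto_def)
  qed (use g in auto)
  then show ?thesis by blast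
qed

text \<open>The event says that for every truncation level \<open>m \<ge> R\<close> the fine Euler schemes leave
  through the bottom \<open>1 / (m + 1)\<close> of the band. For a single large \<open>m\<close> the probability is at most a constant
  divided by \<open>ln ((R + 2) * (m + 1))\<close>, so the intersection over all \<open>m\<close> is null.\<close>

lemma AE_no_low_exit:
  fixes R :: nat and T :: real
  assumes T: "T > 0"
  shows "AE \<omega> in M. \<not> (\<forall>m\<ge>R. \<forall>\<^sub>F n in sequentially.
    euler (truncate_drift f m) {1 / real (Suc m)..real R + 1} \<sigma> y0 (T / real (Suc n)) (\<lambda>t. W t \<omega>) (Suc n) < 1 / real (Suc m))"
proof (cases "y0 \<le> real R + 1")
  case False
  have "\<not> (\<forall>\<^sub>F n in sequentially. euler (truncate_drift f m) {1 / real (Suc m)..real R + 1} \<sigma> y0 (T / real (Suc n)) (\<lambda>t. W t \<omega>) (Suc n) < 1 / real (Suc m))"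
    if "1 / real (Suc m) \<le> y0" for m \<omega>
  proof -
    have "euler (truncate_drift f m) {1 / real (Suc m)..real R + 1} \<sigma> y0 h w n = y0" for h w n
      using euler_frozen[of "truncate_drift f m" "{1 / real (Suc m)..real R + 1}" \<sigma> y0 h w 0 n] False by simp
    then show ?thesis using that by (simp del: euler.simps of_nat_Suc)
  qed
  moreover have "1 / real (Suc R) \<le> y0"
  proof -
    have "1 / real (Suc R) \<le> 1" by simp
    then show ?thesis using False by linarith
  qed
  ultimately show ?thesis by blast
next
  case True
  define E where "E = (\<lambda>m. {\<omega> \<in> space M. \<forall>\<^sub>F n in sequentially.
    euler (truncate_drift f m) {1 / real (Suc m)..real R + 1} \<sigma> y0 (T / real (Suc n)) (\<lambda>t. W t \<omega>) (Suc n) < 1 / real (Suc m)})"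
  obtain C0 where "\<And>x. 0 < x \<Longrightarrow> x \<le> real R + 1 \<Longrightarrow> \<sigma>\<^sup>2 / 2 - C0 * x\<^sup>2 \<le> x * f x"
    using repelling[of "real R + 1"] by blast
  then have C: "\<sigma>\<^sup>2 / 2 - max C0 0 * x\<^sup>2 \<le> x * f x" if "0 < x" "x \<le> real R + 1" for x
  proof -
    have "C0 * x\<^sup>2 \<le> max C0 0 * x\<^sup>2" by (rule mult_right_mono) auto
    then show ?thesis using \<open>\<And>x. 0 < x \<Longrightarrow> x \<le> real R + 1 \<Longrightarrow> _\<close>[OF that] by linarith
  qed
  define K where "K = ln ((real R + 2) / y0) + max C0 0 * T"
  obtain m0 where m0: "inverse (real (Suc m0)) < y0" using reals_Archimedean[OF y0] by blast
  have est: "E m \<in> events" "prob (E m) * ln ((real R + 2) * real (Suc m)) \<le> K" if "m \<ge> max m0 R" for m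
  proof -
    obtain G where G: "\<And>x. \<bar>truncate_drift f m x\<bar> \<le> G" using trunc_bounded by blast
    have "1 / real (Suc m) \<le> 1 / real (Suc m0)" using that by (intro frac_le) auto
    then have low: "1 / real (Suc m) \<le> y0" using m0 by (simp add: inverse_eq_divide)
    have "1 / real (Suc m) \<le> 1" by simp
    then have ord: "1 / real (Suc m) \<le> real R + 1" by linarith
    have drift: "\<sigma>\<^sup>2 / 2 - max C0 0 * x\<^sup>2 \<le> x * truncate_drift f m x" if x: "x \<in> {1 / real (Suc m)..real R + 1}" for x
    proof -
      have "real R + 1 \<le> real (Suc m)" using \<open>m \<ge> max m0 R\<close> by simp
      then have "x \<in> band m" using x by auto
      moreover have "0 < x" using x by (auto intro: less_le_trans[of 0 "1 / real (Suc m)"])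
      ultimately show ?thesis using C x truncate_drift_eq by auto
    qed
    have G': "\<bar>truncate_drift f m x\<bar> \<le> G" if "x \<in> {1 / real (Suc m)..real R + 1}" for x by (rule G)
    have pos: "0 < 1 / real (Suc m)" by simp
    have nonneg: "0 \<le> max C0 0" by simp
    have R2: "real R + 1 + 1 = real R + 2" by simp
    have quot: "(real R + 2) / (1 / real (Suc m)) = (real R + 2) * real (Suc m)" by simp
    show "E m \<in> events" unfolding E_def
      by (rule euler_low_exit_prob(1)[where G = G and C = "max C0 0"])
        (fact pos ord low True T trunc_measurable G' drift nonneg)+
    have "prob (E m) * ln ((real R + 1 + 1) / (1 / real (Suc m))) \<le> ln ((real R + 1 + 1) / y0) + max C0 0 * T"
      unfolding E_def
      by (rule euler_low_exit_prob(2)[where G = G and C = "max C0 0"])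
        (fact pos ord low True T trunc_measurable G' drift nonneg)+
    then show "prob (E m) * ln ((real R + 2) * real (Suc m)) \<le> K" unfolding R2 quot K_def .
  qed
  define N where "N = (\<Inter>m\<in>{max m0 R..}. E m)"
  have N: "N \<in> events" unfolding N_def using est(1) by (intro sets.countable_INT) auto
  have "prob N = 0"
  proof (rule ccontr)
    assume "prob N \<noteq> 0"
    then have p: "prob N > 0" using measure_nonneg[of M N] by linarith
    have "filterlim (\<lambda>m. real (Suc m)) at_top sequentially"
      using filterlim_compose[OF filterlim_real_sequentially filterlim_Suc] .
    then have "filterlim (\<lambda>m. (real R + 2) * real (Suc m)) at_top sequentially"
      by (rule filterlim_tendsto_pos_mult_at_top[OF tendsto_const, rotated]) simp
    then have "filterlim (\<lambda>m. ln ((real R + 2) * real (Suc m))) at_top sequentially"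
      by (rule filterlim_compose[OF ln_at_top])
    then have "filterlim (\<lambda>m. prob N * ln ((real R + 2) * real (Suc m))) at_top sequentially"
      by (rule filterlim_tendsto_pos_mult_at_top[OF tendsto_const p])
    then have "\<forall>\<^sub>F m in sequentially. K < prob N * ln ((real R + 2) * real (Suc m))"
      by (simp add: filterlim_at_top_dense)
    then have "\<forall>\<^sub>F m in sequentially. False"
      using eventually_ge_at_top[of "max m0 R"]
    proof eventually_elim
      case (elim m)
      have "prob N \<le> prob (E m)" using elim est(1) N by (intro finite_measure_mono) (auto simp: N_def)
      moreover have "0 \<le> ln ((real R + 2) * real (Suc m))"
      proof (rule ln_ge_zero)
        have "1 * 1 \<le> (real R + 2) * real (Suc m)" by (rule mult_mono) auto
        then show "1 \<le> (real R + 2) * real (Suc m)" by simp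
      qed
      ultimately have "prob N * ln ((real R + 2) * real (Suc m)) \<le> K"
        using est(2)[of m] elim mult_right_mono by (meson order.trans)
      then show False using elim by linarith
    qed
    then show False by simp
  qed
  then have "N \<in> null_sets M" using N by (simp add: null_sets_def emeasure_eq_measure)
  then have "AE \<omega> in M. \<omega> \<notin> N" by (rule AE_not_in)
  then show ?thesis using AE_space
    by eventually_elim (auto simp: N_def E_def simp del: euler.simps of_nat_Suc)
qed

text \<open>For a fixed path the truncated solutions have a common upper bound. If none of them were
  confined to its band, those with a large level would all dip below the bottom of the band,
  and the Euler schemes would follow them.\<close>

lemma AE_confined: "AE \<omega> in M. confined \<omega>"
proof -
  have "AE \<omega> in M. \<forall>R T::nat. \<not> (\<forall>m\<ge>R. \<forall>\<^sub>F n in sequentially.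
    euler (truncate_drift f m) {1 / real (Suc m)..real R + 1} \<sigma> y0 (real (Suc T) / real (Suc n)) (\<lambda>t. W t \<omega>) (Suc n) < 1 / real (Suc m))"
    unfolding AE_all_countable by (intro allI AE_no_low_exit) simp
  with AE_good_path show ?thesis
  proof eventually_elim
    case (elim \<omega>)
    note gp = elim(1)
    show ?case unfolding confined_def
    proof (intro conjI gp allI)
      fix N :: nat
      obtain R0 where R0: "\<And>m t. t \<in> {0..real (Suc N)} \<Longrightarrow> trunc_sol m \<omega> t \<le> R0"
        using trunc_sol_bounded_above[OF gp] by blast
      obtain R :: nat where R: "R0 \<le> real R" using real_arch_simple by blast
      obtain m where m: "m \<ge> R" and ne: "\<not> (\<forall>\<^sub>F n in sequentially.
        euler (truncate_drift f m) {1 / real (Suc m)..real R + 1} \<sigma> y0 (real (Suc N) / real (Suc n)) (\<lambda>t. W t \<omega>) (Suc n) < 1 / real (Suc m))"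
        using elim(2) by blast
      obtain L where L: "L-lipschitz_on UNIV (truncate_drift f m)" using trunc_lipschitz by blast
      have upper: "trunc_sol m \<omega> t \<le> real R" if "t \<in> {0..real (Suc N)}" for t
        using R0[OF that] R order_trans by blast
      have low: "1 / real (Suc m) \<le> trunc_sol m \<omega> t" if "t \<in> {0..real (Suc N)}" for t
      proof (rule ccontr)
        assume "\<not> ?thesis"
        then have "trunc_sol m \<omega> t < 1 / real (Suc m)" by simp
        then show False
          using euler_low_exit[OF L trunc_sol[OF gp] _ upper that] ne gp by (auto simp: good_path_def)
      qed
      have "trunc_sol m \<omega> t \<in> band m" if "t \<in> {0..real N}" for t
        using upper[of t] low[of t] m that by simp
      then show "\<exists>m. trunc_sol m \<omega> ` {0..real N} \<subseteq> band m" by blast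
    qed
  qed
qed

lemma confined_solution:
  assumes c: "confined \<omega>" and T: "0 \<le> T"
  obtains a b where "0 < a" "(\<lambda>t. Y t \<omega>) ` {0..T} \<subseteq> {a..b}"
    "solves_upto T f \<sigma> y0 (\<lambda>t. W t \<omega>) (\<lambda>t. Y t \<omega>)"
proof -
  obtain N :: nat where N: "T \<le> real N" using real_arch_simple by blast
  have gp: "good_path \<omega>" using c by (simp add: confined_def)
  obtain m where m: "trunc_sol m \<omega> ` {0..real N} \<subseteq> band m" using c by (auto simp: confined_def)
  then have b: "trunc_sol m \<omega> ` {0..T} \<subseteq> band m" using N by (force simp: image_subset_iff)
  have eq: "Y t \<omega> = trunc_sol m \<omega> t" if "t \<in> {0..T}" for t by (rule Y_eq_trunc_sol[OF gp b that])
  have s: "solves_upto T f \<sigma> y0 (\<lambda>t. W t \<omega>) (trunc_sol m \<omega>)" by (rule solves_f_if_in_band[OF gp b])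
  have "solves_upto T f \<sigma> y0 (\<lambda>t. W t \<omega>) (\<lambda>t. Y t \<omega>)"
  proof -
    have "integral {0..t} (\<lambda>s. f (Y s \<omega>)) = integral {0..t} (\<lambda>s. f (trunc_sol m \<omega> s))" if "t \<in> {0..T}" for t
      by (rule integral_cong) (use eq that in auto)
    moreover have "continuous_on {0..T} (\<lambda>t. Y t \<omega>) \<longleftrightarrow> continuous_on {0..T} (trunc_sol m \<omega>)"
      by (rule continuous_on_cong) (use eq in auto)
    ultimately show ?thesis using s eq by (simp add: solves_upto_def)
  qed
  moreover have "(\<lambda>t. Y t \<omega>) ` {0..T} \<subseteq> band m" using eq b by (simp add: image_subset_iff)
  ultimately show ?thesis using that[of "1 / real (Suc m)" "real (Suc m)"] by simp
qed

theorem positive_global_solution_Y: "positive_global_solution M F W f \<sigma> y0 Y"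
  unfolding positive_global_solution_def
proof (intro conjI allI impI Y_adapted)
  show "AE \<omega> in M. continuous_on {0..} (\<lambda>t. Y t \<omega>)"
    using AE_confined
  proof eventually_elim
    case (elim \<omega>)
    show ?case
    proof (rule continuous_on_halfline)
      fix T :: real assume "0 \<le> T"
      then obtain a b where "solves_upto T f \<sigma> y0 (\<lambda>t. W t \<omega>) (\<lambda>t. Y t \<omega>)"
        using confined_solution[OF elim] by blast
      then show "continuous_on {0..T} (\<lambda>t. Y t \<omega>)" by (simp add: solves_upto_def)
    qed
  qed
  show "AE \<omega> in M. Y 0 \<omega> = y0"
    using AE_confined
  proof eventually_elim
    case (elim \<omega>)
    then have "W 0 \<omega> = 0" by (simp add: confined_def good_path_def)
    moreover obtain a b where "solves_upto 0 f \<sigma> y0 (\<lambda>t. W t \<omega>) (\<lambda>t. Y t \<omega>)"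
      using confined_solution[OF elim order_refl] .
    ultimately show ?case by (simp add: solves_upto_def)
  qed
  show "AE \<omega> in M. \<forall>t\<ge>0. 0 < Y t \<omega>"
    using AE_confined
  proof eventually_elim
    case (elim \<omega>)
    show ?case
    proof (intro allI impI)
      fix t :: real assume t: "0 \<le> t"
      obtain a b where "0 < a" "(\<lambda>t. Y t \<omega>) ` {0..t} \<subseteq> {a..b}" using confined_solution[OF elim t] .
      then show "0 < Y t \<omega>" using t by (force simp: image_subset_iff)
    qed
  qed
  show "\<exists>I. is_ito_integral_process M F W (\<lambda>_ _. \<sigma>) I \<and>
       (AE \<omega> in M. \<forall>t\<ge>0. set_integrable lborel {0..t} (\<lambda>s. f (Y s \<omega>)) \<and>
          Y t \<omega> = Y 0 \<omega> + (LBINT s:{0..t}. f (Y s \<omega>)) + I t \<omega>)"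
  proof (intro exI conjI)
    show "is_ito_integral_process M F W (\<lambda>_ _. \<sigma>) (\<lambda>t \<omega>. \<sigma> * W t \<omega>)" by (rule ito_integral_process_const)
    show "AE \<omega> in M. \<forall>t\<ge>0. set_integrable lborel {0..t} (\<lambda>s. f (Y s \<omega>)) \<and>
          Y t \<omega> = Y 0 \<omega> + (LBINT s:{0..t}. f (Y s \<omega>)) + \<sigma> * W t \<omega>"
      using AE_confined
    proof eventually_elim
      case (elim \<omega>)
      show ?case
      proof (intro allI impI)
        fix t :: real assume t: "0 \<le> t"
        obtain a b where ab: "0 < a" "(\<lambda>t. Y t \<omega>) ` {0..t} \<subseteq> {a..b}"
          and s: "solves_upto t f \<sigma> y0 (\<lambda>t. W t \<omega>) (\<lambda>t. Y t \<omega>)" using confined_solution[OF elim t] .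
        obtain L where "L-lipschitz_on {a..b} f" using lipschitz[OF ab(1)] by blast
        then have "continuous_on {0..t} (\<lambda>s. f (Y s \<omega>))"
          using continuous_drift ab(2) s unfolding solves_upto_def by blast
        then have i: "set_integrable lborel {0..t} (\<lambda>s. f (Y s \<omega>))" by (rule borel_integrable_atLeastAtMost')
        have "W 0 \<omega> = 0" using elim by (simp add: confined_def good_path_def)
        then show "set_integrable lborel {0..t} (\<lambda>s. f (Y s \<omega>)) \<and>
          Y t \<omega> = Y 0 \<omega> + (LBINT s:{0..t}. f (Y s \<omega>)) + \<sigma> * W t \<omega>"
          using i s t set_borel_integral_eq_integral(2)[OF i] by (auto simp: solves_upto_def)
      qed
    qed
  qed
qed

text \<open>Any other solution is driven by \<open>\<sigma> * W\<close> as well, so on almost every path both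
  processes solve the same integral equation with values in one compact subset of the open half
  line, where the drift is Lipschitz.\<close>

theorem positive_global_solution_unique:
  assumes Z: "positive_global_solution M F W f \<sigma> y0 Z"
  shows "AE \<omega> in M. \<forall>t\<ge>0. Z t \<omega> = Y t \<omega>"
proof -
  obtain I where I: "is_ito_integral_process M F W (\<lambda>_ _. \<sigma>) I"
    and eq: "AE \<omega> in M. \<forall>t\<ge>0. set_integrable lborel {0..t} (\<lambda>s. f (Z s \<omega>)) \<and>
          Z t \<omega> = Z 0 \<omega> + (LBINT s:{0..t}. f (Z s \<omega>)) + I t \<omega>"
    using Z unfolding positive_global_solution_def by blast
  have "AE \<omega> in M. continuous_on {0..} (\<lambda>t. Z t \<omega>)" "AE \<omega> in M. Z 0 \<omega> = y0"
    "AE \<omega> in M. \<forall>t\<ge>0. 0 < Z t \<omega>"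
    using Z unfolding positive_global_solution_def by blast+
  then show ?thesis using eq ito_integral_process_const_unique[OF I] AE_confined
  proof eventually_elim
    case (elim \<omega>)
    show ?case
    proof (intro allI impI)
      fix t :: real assume t: "0 \<le> t"
      obtain a b where ab: "0 < a" "(\<lambda>t. Y t \<omega>) ` {0..t} \<subseteq> {a..b}"
        and s: "solves_upto t f \<sigma> y0 (\<lambda>t. W t \<omega>) (\<lambda>t. Y t \<omega>)" using confined_solution[OF elim(6) t] .
      have zc: "continuous_on {0..t} (\<lambda>t. Z t \<omega>)" using elim(1) by (rule continuous_on_subset) auto
      obtain c d where cd: "0 < c" "(\<lambda>t. Z t \<omega>) ` {0..t} \<subseteq> {c..d}"
        using positive_continuous_image[OF zc] elim(3) by auto
      have z: "solves_upto t f \<sigma> y0 (\<lambda>t. W t \<omega>) (\<lambda>t. Z t \<omega>)"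
        unfolding solves_upto_def
      proof (intro conjI ballI zc)
        fix u assume "u \<in> {0..t}"
        then have u: "0 \<le> u" by simp
        have i: "set_integrable lborel {0..u} (\<lambda>s. f (Z s \<omega>))" using elim(4) u by blast
        have "Z u \<omega> = Z 0 \<omega> + (LBINT s:{0..u}. f (Z s \<omega>)) + I u \<omega>" using elim(4) u by blast
        then show "Z u \<omega> = y0 + integral {0..u} (\<lambda>s. f (Z s \<omega>)) + \<sigma> * W u \<omega>"
          using set_borel_integral_eq_integral(2)[OF i] elim(2,5) u by simp
      qed
      obtain L where L: "L-lipschitz_on {min a c..max b d} f" using lipschitz[of "min a c"] ab cd by fastforce
      show "Z t \<omega> = Y t \<omega>"
        by (rule solution_unique[OF L z _ s]) (use ab cd t in \<open>force simp: image_subset_iff\<close>)+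
    qed
  qed
qed

end

section \<open>The transformed Ait-Sahalia drift\<close>

lemma powr_lipschitz_on_interval:
  fixes a b e :: real
  assumes a: "0 < a"
  shows "\<exists>L. L-lipschitz_on {a..b} (\<lambda>x. x powr e)"
proof -
  have "bounded ((\<lambda>x. e * x powr (e - 1)) ` {a..b})"
    using a by (intro compact_imp_bounded compact_continuous_image continuous_intros) auto
  then obtain B where B: "\<forall>x\<in>{a..b}. \<bar>e * x powr (e - 1)\<bar> \<le> B" unfolding bounded_iff by auto
  have "(max B 0)-lipschitz_on {a..b} (\<lambda>x. x powr e)"
  proof (rule bounded_derivative_imp_lipschitz[where f' = "\<lambda>x h. e * x powr (e - 1) * h"])
    fix x assume x: "x \<in> {a..b}"
    have "((\<lambda>x. x powr e) has_real_derivative e * x powr (e - 1)) (at x)"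
      using x a by (intro has_real_derivative_powr) auto
    then show "((\<lambda>x. x powr e) has_derivative (\<lambda>h. e * x powr (e - 1) * h)) (at x within {a..b})"
      unfolding has_field_derivative_def by (rule has_derivative_at_withinI)
    show "onorm (\<lambda>h. e * x powr (e - 1) * h) \<le> max B 0"
    proof (rule onorm_bound)
      fix h :: real
      have "\<bar>e * x powr (e - 1)\<bar> \<le> max B 0" using B x by fastforce
      then show "norm (e * x powr (e - 1) * h) \<le> max B 0 * norm h"
        unfolding real_norm_def abs_mult[of _ h] by (rule mult_right_mono) simp
    qed simp
  qed auto
  then show ?thesis by blast
qed

lemma lamperti_drift_lipschitz:
  assumes a: "0 < a"
  shows "\<exists>L. L-lipschitz_on {a..c} (lamperti_drift am1 a0 a1 a2 b \<gamma> \<theta>)"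
proof -
  obtain L1 L2 L3 L4 L5 where
    L: "L1-lipschitz_on {a..c} (\<lambda>x. x powr ((\<gamma> - \<theta>) / (1 - \<theta>)))"
       "L2-lipschitz_on {a..c} (\<lambda>x. x powr 1)"
       "L3-lipschitz_on {a..c} (\<lambda>x. x powr ((\<theta> + 1) / (\<theta> - 1)))"
       "L4-lipschitz_on {a..c} (\<lambda>x. x powr (\<theta> / (\<theta> - 1)))"
       "L5-lipschitz_on {a..c} (\<lambda>x. x powr (- 1))"
    using powr_lipschitz_on_interval[OF a] by metis
  note scaled = L(1)[THEN lipschitz_on_cmult_real, of a2] L(2)[THEN lipschitz_on_cmult_real, of a1]
    L(3)[THEN lipschitz_on_cmult_real, of am1] L(4)[THEN lipschitz_on_cmult_real, of a0]
    L(5)[THEN lipschitz_on_cmult_real, of "1 / 2 * b\<^sup>2 * \<theta>"]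
  note lip = lipschitz_on_cmult_real[OF lipschitz_on_add[OF lipschitz_on_add[OF lipschitz_on_diff[OF
    lipschitz_on_diff[OF scaled(1,2)] scaled(3)] scaled(4)] scaled(5)], of "\<theta> - 1"]
  have "\<exists>K. K-lipschitz_on {a..c} (lamperti_drift am1 a0 a1 a2 b \<gamma> \<theta>)"
    by (rule exI, rule lipschitz_on_transform[OF lip])
      (use a in \<open>auto simp: lamperti_drift_def powr_minus\<close>)
  then show ?thesis by blast
qed

text \<open>In terms of \<open>u\<close> the growth of the two positive powers can be compared directly: the damping term
  exceeds the pushing term by one factor \<open>u\<close>.\<close>

lemma lamperti_exponents:
  assumes "\<theta> > 1" "x > (0::real)"
  defines "u \<equiv> x powr (1 / (\<theta> - 1))"
  shows "x powr (\<theta> / (\<theta> - 1)) = x * u" "x powr ((\<theta> + 1) / (\<theta> - 1)) = x * u\<^sup>2"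
proof -
  have e: "\<theta> / (\<theta> - 1) = 1 + 1 / (\<theta> - 1)" "(\<theta> + 1) / (\<theta> - 1) = 1 + (1 / (\<theta> - 1) + 1 / (\<theta> - 1))"
    using assms by (auto simp: field_simps)
  show "x powr (\<theta> / (\<theta> - 1)) = x * u" "x powr ((\<theta> + 1) / (\<theta> - 1)) = x * u\<^sup>2"
    unfolding e powr_add u_def using assms by (auto simp: power2_eq_square)
qed

text \<open>Since \<open>\<gamma> > 1\<close>, the \<open>a2\<close> term grows more slowly than \<open>x\<close>, so on \<open>x \<ge> 1\<close> it can be absorbed into the
  \<open>a0\<close> term. The damping \<open>am1\<close> term wins against both as soon as \<open>u \<ge> (a2 + a0) / am1\<close>, and
  smaller \<open>u\<close> means bounded \<open>x\<close>.\<close>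

lemma lamperti_drift_upper:
  assumes "am1 > 0" "a0 > 0" "a1 > 0" "a2 > 0" "\<gamma> > 1" "\<theta> > 1"
  shows "\<exists>C. \<forall>x\<ge>1. lamperti_drift am1 a0 a1 a2 b \<gamma> \<theta> x \<le> C"
proof -
  define r where "r = (a2 + a0) / am1"
  have r: "r > 0" using assms by (simp add: r_def)
  define C where "C = (a2 + a0) * (r powr (\<theta> - 1) * r)"
  have C0: "C \<ge> 0" using assms r by (simp add: C_def)
  have "lamperti_drift am1 a0 a1 a2 b \<gamma> \<theta> x \<le> (\<theta> - 1) * (C + 1 / 2 * b\<^sup>2 * \<theta>)" if x: "x \<ge> 1" for x
  proof -
    define u where "u = x powr (1 / (\<theta> - 1))"
    have u: "u > 0" using x by (simp add: u_def)
    note e = lamperti_exponents[of \<theta> x, folded u_def]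
    have "(\<gamma> - \<theta>) / (1 - \<theta>) \<le> 1" using assms by (simp add: field_simps)
    also have "1 \<le> \<theta> / (\<theta> - 1)" using assms by (simp add: field_simps)
    finally have "x powr ((\<gamma> - \<theta>) / (1 - \<theta>)) \<le> x * u"
      using x assms e(1) powr_mono[of "(\<gamma> - \<theta>) / (1 - \<theta>)" "\<theta> / (\<theta> - 1)" x] by simp
    then have "a2 * x powr ((\<gamma> - \<theta>) / (1 - \<theta>)) \<le> a2 * (x * u)" using assms by (intro mult_left_mono) auto
    moreover have "0 \<le> a1 * x" using assms x by simp
    moreover have "1 / 2 * b\<^sup>2 * \<theta> * inverse x \<le> 1 / 2 * b\<^sup>2 * \<theta> * 1"
      using assms x by (intro mult_left_mono) (auto simp: field_simps)
    moreover have "(a2 + a0) * (x * u) - am1 * (x * u\<^sup>2) \<le> C"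
    proof (cases "u \<ge> r")
      case True
      then have "a2 + a0 \<le> am1 * u" using assms by (simp add: r_def field_simps)
      then have "(a2 + a0) * (x * u) \<le> (am1 * u) * (x * u)" using x u by (intro mult_right_mono) auto
      then show ?thesis using C0 by (simp add: power2_eq_square algebra_simps)
    next
      case False
      have "x = u powr (\<theta> - 1)" using x assms by (simp add: u_def powr_powr)
      also have "\<dots> \<le> r powr (\<theta> - 1)" using False u assms by (intro powr_mono2) auto
      finally have "x * u \<le> r powr (\<theta> - 1) * r" using False u x by (intro mult_mono) auto
      then have "(a2 + a0) * (x * u) \<le> C" unfolding C_def using assms by (intro mult_left_mono) auto
      moreover have "0 \<le> am1 * (x * u\<^sup>2)" using assms x by simp
      ultimately show ?thesis by linarith
    qed
    ultimately have "a2 * x powr ((\<gamma> - \<theta>) / (1 - \<theta>)) - a1 * x - am1 * (x * u\<^sup>2) + a0 * (x * u)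
        + 1 / 2 * b\<^sup>2 * \<theta> * inverse x \<le> C + 1 / 2 * b\<^sup>2 * \<theta>" by (simp add: distrib_right)
    moreover have "0 < x" using x by simp
    ultimately show ?thesis
      unfolding lamperti_drift_def e(1)[OF \<open>\<theta> > 1\<close> \<open>0 < x\<close>] e(2)[OF \<open>\<theta> > 1\<close> \<open>0 < x\<close>]
      using assms by (intro mult_left_mono) auto
  qed
  then show ?thesis by blast
qed

text \<open>Near zero the drift is at least \<open>c / x\<close> with \<open>c = (\<theta> - 1) * b\<^sup>2 * \<theta> / 2\<close>, up to terms that are of order
  \<open>x\<close>. Since \<open>\<theta> \<ge> \<theta> - 1\<close>, this \<open>c\<close> is at least half of the squared noise coefficient
  \<open>b\<^sup>2 * (\<theta> - 1)\<^sup>2\<close>. The \<open>a0\<close> and \<open>a2\<close> terms only help.\<close>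

lemma lamperti_drift_repelling:
  assumes "am1 > 0" "a0 > 0" "a2 > 0" "\<theta> > 1"
  shows "\<exists>C. \<forall>x. 0 < x \<longrightarrow> x \<le> R \<longrightarrow>
    (b * (1 - \<theta>))\<^sup>2 / 2 - C * x\<^sup>2 \<le> x * lamperti_drift am1 a0 a1 a2 b \<gamma> \<theta> x"
proof -
  define U where "U = R powr (1 / (\<theta> - 1))"
  have "(b * (1 - \<theta>))\<^sup>2 / 2 - (\<theta> - 1) * (a1 + am1 * U\<^sup>2) * x\<^sup>2 \<le> x * lamperti_drift am1 a0 a1 a2 b \<gamma> \<theta> x"
    if x: "0 < x" "x \<le> R" for x
  proof -
    define u where "u = x powr (1 / (\<theta> - 1))"
    have u: "0 \<le> u" "u \<le> U" unfolding u_def U_def using x assms by (auto intro!: powr_mono2)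
    have e: "x powr ((\<theta> + 1) / (\<theta> - 1)) = x * u\<^sup>2"
      unfolding u_def using assms x by (intro lamperti_exponents(2)) auto
    define P where "P = x * (a2 * x powr ((\<gamma> - \<theta>) / (1 - \<theta>)) + a0 * x powr (\<theta> / (\<theta> - 1)))"
    have P: "P \<ge> 0" using assms x by (simp add: P_def)
    have "x * lamperti_drift am1 a0 a1 a2 b \<gamma> \<theta> x
      = (\<theta> - 1) * (P - a1 * x\<^sup>2 - am1 * (x\<^sup>2 * u\<^sup>2) + 1 / 2 * b\<^sup>2 * \<theta>)"
      unfolding lamperti_drift_def e P_def using x by (simp add: field_simps power2_eq_square)
    moreover have "am1 * (x\<^sup>2 * u\<^sup>2) \<le> am1 * (x\<^sup>2 * U\<^sup>2)"
      using assms u by (intro mult_left_mono power_mono) auto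
    then have "1 / 2 * b\<^sup>2 * \<theta> - a1 * x\<^sup>2 - am1 * (x\<^sup>2 * U\<^sup>2)
        \<le> P - a1 * x\<^sup>2 - am1 * (x\<^sup>2 * u\<^sup>2) + 1 / 2 * b\<^sup>2 * \<theta>"
      using P by linarith
    ultimately have "(\<theta> - 1) * (1 / 2 * b\<^sup>2 * \<theta> - a1 * x\<^sup>2 - am1 * (x\<^sup>2 * U\<^sup>2))
        \<le> x * lamperti_drift am1 a0 a1 a2 b \<gamma> \<theta> x"
      using assms by (simp only: mult_left_mono)
    moreover have "(b * (1 - \<theta>))\<^sup>2 / 2 \<le> (\<theta> - 1) * (1 / 2 * b\<^sup>2 * \<theta>)"
    proof -
      have "(\<theta> - 1) * (1 / 2 * b\<^sup>2 * \<theta>) - (b * (1 - \<theta>))\<^sup>2 / 2 = (\<theta> - 1) * b\<^sup>2 / 2"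
        by (simp add: power2_eq_square field_simps)
      also have "\<dots> \<ge> 0" using assms by simp
      finally show ?thesis by simp
    qed
    moreover have "(\<theta> - 1) * (1 / 2 * b\<^sup>2 * \<theta> - a1 * x\<^sup>2 - am1 * (x\<^sup>2 * U\<^sup>2))
      = (\<theta> - 1) * (1 / 2 * b\<^sup>2 * \<theta>) - (\<theta> - 1) * (a1 + am1 * U\<^sup>2) * x\<^sup>2"
      by (simp add: algebra_simps)
    ultimately show ?thesis by linarith
  qed
  then show ?thesis by blast
qed

theorem proposition2:
  fixes M :: "'a measure" and F :: "real \<Rightarrow> 'a measure" and W :: "real \<Rightarrow> 'a \<Rightarrow> real"
    and am1 a0 a1 a2 b \<gamma> \<theta> x0 :: real
  assumes "brownian_motion M F W"
    and "am1 > 0" and "a0 > 0" and "a1 > 0" and "a2 > 0" and "b > 0"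
    and "\<gamma> > 1" and "\<theta> > 1" and "x0 > 0"
  shows "\<exists>Y. positive_global_solution M F W (lamperti_drift am1 a0 a1 a2 b \<gamma> \<theta>)
               (b * (1 - \<theta>)) (x0 powr (1 - \<theta>)) Y \<and>
             (\<forall>Z. positive_global_solution M F W (lamperti_drift am1 a0 a1 a2 b \<gamma> \<theta>)
                    (b * (1 - \<theta>)) (x0 powr (1 - \<theta>)) Z \<longrightarrow>
                  (AE \<omega> in M. \<forall>t\<ge>0. Z t \<omega> = Y t \<omega>))"
proof -
  interpret brownian_motion M F W by fact
  interpret positive_drift_sde M F W "lamperti_drift am1 a0 a1 a2 b \<gamma> \<theta>" "b * (1 - \<theta>)" "x0 powr (1 - \<theta>)"
  proof
    show "0 < x0 powr (1 - \<theta>)" using \<open>x0 > 0\<close> by simp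
  qed (use lamperti_drift_lipschitz lamperti_drift_upper lamperti_drift_repelling assms in auto)
  show ?thesis
    using positive_global_solution_Y positive_global_solution_unique by blast
qed

end
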